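(* Let $d\ge2$ and let $(f_k)$ be a sequence in $\mathrm{Rat}_d$ converging in $\overline{\mathrm{Rat}}_d$ to a point $f_0\in\partial\mathrm{Rat}_d$. Let $(A_k)$ be a sequence of Möbius transformations such that $A_k\circ f_k$ converges in $\overline{\mathrm{Rat}}_d$ to a point $\Phi$ whose reduction $\phi$ has degree $>0$; if the reduction of $f_0$ is nonconstant, take $A_k=\mathrm{id}$ for all $k$ (so $\Phi=f_0$). Let $\mu_{f_k}$ be the measure of maximal entropy of $f_k$. Then any $\{A_k\}$-weak limit $(\mu_C,\mu_E)$ of the measures $\mu_{f_k}$ satisfies $$\frac1d\,\Phi^*(\mu_C,\mu_E)=\mu_C$$ as measures on $\mathbb{P}^1$.
   Context: All objects are over $\mathbb{C}$; $\mathbb{P}^1=\mathbb{P}^1(\mathbb{C})$. $\mathrm{Rat}_d$ (rational functions of degree exactly $d$) is identified via coefficients with an open subset of $\overline{\mathrm{Rat}}_d=\mathbb{P}^{2d+1}(\mathbb{C})$; a point $\Phi\in\overline{\mathrm{Rat}}_d$ is a pair $(P,Q)$ of homogeneous polynomials of degree $d$ in two variables, not both zero, up to common scaling, and $\partial\mathrm{Rat}_d=\{\mathrm{Res}(P,Q)=0\}$. For $\Phi=(P,Q)$ let $H=\gcd(P,Q)$; the reduction of $\Phi$ is the rational function $\phi$ given by the ratio $P/Q$ (after cancelling $H$). For $x\in\mathbb{P}^1$, the surplus multiplicity is $s(x)=\mathrm{ord}_xH$. A paired measure $(\mu_C,\mu_E)$ is a pair of Borel probability measures on two copies $C,E$ of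 $\mathbb{P}^1$. A sequence of Borel probability measures $\mu_k$ on $\mathbb{P}^1$ converges $\{A_k\}$-weakly to $(\mu_C,\mu_E)$ if $\mu_k\to\mu_C$ and $(A_k)_*\mu_k\to\mu_E$ weakly. An $\{A_k\}$-weak limit of $(\mu_k)$ is a limit of this kind along some subsequence. Define the measure on $\mathbb{P}^1$ $$\Phi^*(\mu_C,\mu_E):=\phi^*\mu_E+\sum_{x\in\mathbb{P}^1}s(x)\delta_x,$$ where $\int\psi\,d(\phi^*\mu_E)=\int\phi_*\psi\,d\mu_E$ and $\phi_*\psi(y)=\sum_{\phi(x)=y}\psi(x)$, preimages counted with multiplicity. The measure of maximal entropy $\mu_f$ of $f\in\mathrm{Rat}_d$ is the unique Borel probability measure on $\mathbb{P}^1$ with $\frac1d f^*\mu_f=\mu_f$ that does not charge exceptional points. *)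

theory Defs
  imports
    "HOL-Probability.Probability"
    "HOL-Computational_Algebra.Computational_Algebra"
    "HOL-Computational_Algebra.Field_as_Ring"
    "Subresultants.Resultant_Prelim"
begin

unbundle no fps_syntax
no_notation vec_index (infixl "$" 100)

section \<open>The projective line\<close>

definition proportional :: "complex^2 \<Rightarrow> complex^2 \<Rightarrow> bool" where
  "proportional v w \<longleftrightarrow> v \<noteq> 0 \<and> w \<noteq> 0 \<and> (\<exists>c. c \<noteq> 0 \<and> w = c *s v)"

lemma part_equivp_proportional: "part_equivp proportional"
proof (rule part_equivpI)
  have "proportional (axis 1 1) (axis 1 1)"
    unfolding proportional_def by (auto simp: axis_eq_0_iff intro!: exI[of _ 1])
  then show "\<exists>x. proportional x x" by blast
  show "symp proportional"
  proof (rule sympI)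
    fix v w assume "proportional v w"
    then obtain c where "v \<noteq> 0" "w \<noteq> 0" "c \<noteq> 0" "w = c *s v"
      unfolding proportional_def by blast
    then show "proportional w v"
      unfolding proportional_def by (auto intro!: exI[of _ "inverse c"] simp: vec_eq_iff)
  qed
  show "transp proportional"
  proof (rule transpI)
    fix u v w assume "proportional u v" "proportional v w"
    then obtain c e where "u \<noteq> 0" "w \<noteq> 0" "c \<noteq> 0" "v = c *s u" "e \<noteq> 0" "w = e *s v"
      unfolding proportional_def by blast
    then show "proportional u w"
      unfolding proportional_def by (auto intro!: exI[of _ "e * c"] simp: vec_eq_iff)
  qed
qed

quotient_type cp1 = "complex^2" / partial: proportional
  by (rule part_equivp_proportional)

instantiation cp1 :: topological_space
begin

definition open_cp1 :: "cp1 set \<Rightarrow> bool" where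
  "open_cp1 U \<longleftrightarrow> open {v. v \<noteq> 0 \<and> abs_cp1 v \<in> U}"

instance
proof
  have "{v :: complex^2. v \<noteq> 0 \<and> abs_cp1 v \<in> UNIV} = - {0}" by auto
  then show "open (UNIV :: cp1 set)"
    unfolding open_cp1_def by (simp only: open_Compl closed_singleton)
next
  fix U V :: "cp1 set" assume "open U" "open V"
  then have "open ({v. v \<noteq> 0 \<and> abs_cp1 v \<in> U} \<inter> {v. v \<noteq> 0 \<and> abs_cp1 v \<in> V})"
    unfolding open_cp1_def by (rule open_Int)
  also have "\<dots> = {v. v \<noteq> 0 \<and> abs_cp1 v \<in> U \<inter> V}" by auto
  finally show "open (U \<inter> V)" unfolding open_cp1_def .
next
  fix K :: "cp1 set set" assume "\<forall>U\<in>K. open U"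
  then have "open (\<Union>U\<in>K. {v. v \<noteq> 0 \<and> abs_cp1 v \<in> U})"
    unfolding open_cp1_def by (rule open_UN)
  also have "\<dots> = {v. v \<noteq> 0 \<and> abs_cp1 v \<in> \<Union>K}" by auto
  finally show "open (\<Union>K)" unfolding open_cp1_def .
qed

end

section \<open>Binary forms and the space of rational maps\<close>

text \<open>
  A polynomial in the two variables $z, w$ is a polynomial in $z$ whose coefficients are
  polynomials in $w$; a binary form is a homogeneous one. A pair of forms $(P, Q)$ stands for
  the point $(P : Q)$ of projective space that it spans. All notions below that take a pair
  depend only on that point.
\<close>

type_synonym bipoly = "complex poly poly"
type_synonym form_pair = "bipoly \<times> bipoly"

definition homogeneous :: "nat \<Rightarrow> bipoly \<Rightarrow> bool" where
  "homogeneous d P \<longleftrightarrow> (\<forall>i j. coeff (coeff P i) j \<noteq> 0 \<longrightarrow> i + j = d)"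

definition eval_form :: "bipoly \<Rightarrow> complex^2 \<Rightarrow> complex" where
  "eval_form P v = poly (poly P [:v $ 1:]) (v $ 2)"

definition form_pairs :: "nat \<Rightarrow> form_pair set" where
  "form_pairs d = {(P, Q). homogeneous d P \<and> homogeneous d Q \<and> (P, Q) \<noteq> (0, 0)}"

definition form_scale :: "complex \<Rightarrow> form_pair \<Rightarrow> form_pair" where
  "form_scale c \<Phi> = (Polynomial.smult [:c:] (fst \<Phi>), Polynomial.smult [:c:] (snd \<Phi>))"

definition proj_class :: "form_pair \<Rightarrow> form_pair set" where
  "proj_class \<Phi> = {form_scale c \<Phi> | c. c \<noteq> 0}"

definition RatBar :: "nat \<Rightarrow> form_pair set set" where
  "RatBar d = proj_class ` form_pairs d"

definition coords :: "form_pair \<Rightarrow> nat \<times> nat \<Rightarrow> complex \<times> complex" where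
  "coords \<Phi> = (\<lambda>(i, j). (coeff (coeff (fst \<Phi>) i) j, coeff (coeff (snd \<Phi>) i) j))"

text \<open>
  On forms of degree $d$ only the $2d+2$ coordinates with $i + j = d$ are not identically zero,
  so the product topology on the function space induces the topology of $\mathbb{C}^{2d+2}$.
\<close>

definition form_pairs_topology :: "nat \<Rightarrow> form_pair topology" where
  "form_pairs_topology d = pullback_topology (form_pairs d) coords euclidean"

definition RatBar_topology :: "nat \<Rightarrow> form_pair set topology" where
  "RatBar_topology d = topology (\<lambda>U. U \<subseteq> RatBar d \<and>
     openin (form_pairs_topology d) {\<Phi> \<in> form_pairs d. proj_class \<Phi> \<in> U})"

lemma topspace_form_pairs_topology [simp]: "topspace (form_pairs_topology d) = form_pairs d"
  by (simp add: form_pairs_topology_def topspace_pullback_topology)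

lemma openin_RatBar_topology:
  "openin (RatBar_topology d) U \<longleftrightarrow>
     U \<subseteq> RatBar d \<and> openin (form_pairs_topology d) {\<Phi> \<in> form_pairs d. proj_class \<Phi> \<in> U}"
proof -
  have "istopology (\<lambda>U. U \<subseteq> RatBar d \<and>
     openin (form_pairs_topology d) {\<Phi> \<in> form_pairs d. proj_class \<Phi> \<in> U})"
    unfolding istopology_def
  proof (intro conjI allI impI)
    fix S T
    assume S: "S \<subseteq> RatBar d \<and> openin (form_pairs_topology d) {\<Phi> \<in> form_pairs d. proj_class \<Phi> \<in> S}"
      and T: "T \<subseteq> RatBar d \<and> openin (form_pairs_topology d) {\<Phi> \<in> form_pairs d. proj_class \<Phi> \<in> T}"
    show "S \<inter> T \<subseteq> RatBar d" using S by blast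
    have "{\<Phi> \<in> form_pairs d. proj_class \<Phi> \<in> S \<inter> T} =
        {\<Phi> \<in> form_pairs d. proj_class \<Phi> \<in> S} \<inter> {\<Phi> \<in> form_pairs d. proj_class \<Phi> \<in> T}" by auto
    then show "openin (form_pairs_topology d) {\<Phi> \<in> form_pairs d. proj_class \<Phi> \<in> S \<inter> T}"
      using S T by auto
  next
    fix K
    assume K: "\<forall>S\<in>K. S \<subseteq> RatBar d \<and>
      openin (form_pairs_topology d) {\<Phi> \<in> form_pairs d. proj_class \<Phi> \<in> S}"
    show "\<Union>K \<subseteq> RatBar d" using K by blast
    have "{\<Phi> \<in> form_pairs d. proj_class \<Phi> \<in> \<Union>K} =
        (\<Union>S\<in>K. {\<Phi> \<in> form_pairs d. proj_class \<Phi> \<in> S})" by auto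
    then show "openin (form_pairs_topology d) {\<Phi> \<in> form_pairs d. proj_class \<Phi> \<in> \<Union>K}"
      using K by auto
  qed
  then show ?thesis by (simp add: RatBar_topology_def topology_inverse')
qed

lemma topspace_RatBar_topology [simp]: "topspace (RatBar_topology d) = RatBar d"
proof -
  have "{\<Phi> \<in> form_pairs d. proj_class \<Phi> \<in> RatBar d} = topspace (form_pairs_topology d)"
    by (auto simp: RatBar_def)
  then have "openin (RatBar_topology d) (RatBar d)"
    unfolding openin_RatBar_topology by (simp only: openin_topspace order_refl simp_thms)
  then show ?thesis
    using openin_subset[of "RatBar_topology d" "RatBar d"]
      openin_topspace[of "RatBar_topology d"]
    unfolding openin_RatBar_topology by (intro subset_antisym) simp_all
qed

lemma quotient_map_proj_class:
  "quotient_map (form_pairs_topology d) (RatBar_topology d) proj_class"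
  by (auto simp: quotient_map_def openin_RatBar_topology RatBar_def)

definition Rat :: "nat \<Rightarrow> form_pair set" where
  "Rat d = {\<Phi> \<in> form_pairs d. coprime (fst \<Phi>) (snd \<Phi>)}"

text \<open>
  The Sylvester matrix of two forms of degree $d$ is that of their dehomogenizations at $w = 1$,
  both taken with formal degree $d$.
\<close>

definition form_resultant :: "nat \<Rightarrow> bipoly \<Rightarrow> bipoly \<Rightarrow> complex" where
  "form_resultant d P Q =
     resultant_sub d d (map_poly (\<lambda>c. poly c 1) P) (map_poly (\<lambda>c. poly c 1) Q)"

definition bdry_Rat :: "nat \<Rightarrow> form_pair set" where
  "bdry_Rat d = {\<Phi> \<in> form_pairs d. form_resultant d (fst \<Phi>) (snd \<Phi>) = 0}"

section \<open>Reduction, multiplicities and pullback of measures\<close>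

definition common_factor :: "form_pair \<Rightarrow> bipoly" where
  "common_factor \<Phi> = gcd (fst \<Phi>) (snd \<Phi>)"

definition reduction :: "form_pair \<Rightarrow> form_pair" where
  "reduction \<Phi> = (fst \<Phi> div common_factor \<Phi>, snd \<Phi> div common_factor \<Phi>)"

text \<open>
  The degree, the induced map, multiplicities of preimages and pullbacks of functions and
  measures are meant for reduced pairs $(p, q)$: coprime forms of the same degree. An element of
  \<^term>\<open>Rat d\<close> is already of this kind.
\<close>

definition rat_degree :: "form_pair \<Rightarrow> nat" where
  "rat_degree \<phi> = (THE e. \<phi> \<in> form_pairs e)"

definition rat_map :: "form_pair \<Rightarrow> cp1 \<Rightarrow> cp1" where
  "rat_map \<phi> x = abs_cp1 (vector [eval_form (fst \<phi>) (rep_cp1 x), eval_form (snd \<phi>) (rep_cp1 x)])"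

definition point_form :: "cp1 \<Rightarrow> bipoly" \<comment> \<open>$bz - aw$ for $x = (a : b)$\<close> where
  "point_form x = [: [:0, - (rep_cp1 x $ 1):], [:rep_cp1 x $ 2:] :]"

definition ord_at :: "cp1 \<Rightarrow> bipoly \<Rightarrow> nat" where
  "ord_at x H = multiplicity (point_form x) H"

definition surplus :: "form_pair \<Rightarrow> cp1 \<Rightarrow> nat" where
  "surplus \<Phi> x = ord_at x (common_factor \<Phi>)"

text \<open>
  For $\phi = (p : q)$ and $\phi(x) = (a : b)$, the multiplicity of $x$ as a preimage of
  $\phi(x)$ is the order of vanishing at $x$ of $bp - aq$.
\<close>

definition local_degree :: "form_pair \<Rightarrow> cp1 \<Rightarrow> nat" where
  "local_degree \<phi> x =
     (let y = rep_cp1 (rat_map \<phi> x) in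
      ord_at x (Polynomial.smult [:y $ 2:] (fst \<phi>) - Polynomial.smult [:y $ 1:] (snd \<phi>)))"

definition push_fun :: "form_pair \<Rightarrow> (cp1 \<Rightarrow> real) \<Rightarrow> cp1 \<Rightarrow> real" where
  "push_fun \<phi> \<psi> y = (\<Sum>x\<in>{x. rat_map \<phi> x = y}. real (local_degree \<phi> x) * \<psi> x)"

definition pullback_measure :: "form_pair \<Rightarrow> cp1 measure \<Rightarrow> cp1 measure" where
  "pullback_measure \<phi> \<mu> = (THE \<nu>. finite_measure \<nu> \<and> sets \<nu> = sets borel \<and>
     (\<forall>\<psi>. continuous_on UNIV \<psi> \<longrightarrow>
        (\<integral>x. \<psi> x \<partial>\<nu>) = (\<integral>y. push_fun \<phi> \<psi> y \<partial>\<mu>)))"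

definition paired_pullback :: "form_pair \<Rightarrow> cp1 measure \<Rightarrow> cp1 measure \<Rightarrow> cp1 measure" where
  "paired_pullback \<Phi> \<mu>\<^sub>C \<mu>\<^sub>E = measure_of UNIV (sets borel)
     (\<lambda>B. emeasure (pullback_measure (reduction \<Phi>) \<mu>\<^sub>E) B +
        (\<Sum>x\<in>{x. surplus \<Phi> x \<noteq> 0}. of_nat (surplus \<Phi> x) * emeasure (return borel x) B))"

section \<open>Measures of maximal entropy\<close>

definition borel_prob :: "cp1 measure \<Rightarrow> bool" where
  "borel_prob \<mu> \<longleftrightarrow> prob_space \<mu> \<and> sets \<mu> = sets borel"

definition grand_orbit :: "form_pair \<Rightarrow> cp1 \<Rightarrow> cp1 set" where
  "grand_orbit f x = {y. \<exists>m n. (rat_map f ^^ m) y = (rat_map f ^^ n) x}"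

definition exceptional :: "form_pair \<Rightarrow> cp1 \<Rightarrow> bool" where
  "exceptional f x \<longleftrightarrow> finite (grand_orbit f x)"

text \<open>
  Existence and uniqueness of such a measure, for rational maps of degree at least 2, is a
  theorem of Freire--Lopes--Mane and Lyubich; it is not built into the definition.
\<close>

definition max_entropy_measure :: "nat \<Rightarrow> form_pair \<Rightarrow> cp1 measure \<Rightarrow> bool" where
  "max_entropy_measure d f \<mu> \<longleftrightarrow> borel_prob \<mu> \<and>
     scale_measure (1 / of_nat d) (pullback_measure f \<mu>) = \<mu> \<and>
     (\<forall>x. exceptional f x \<longrightarrow> emeasure \<mu> {x} = 0)"

section \<open>Moebius transformations and weak limits\<close>

text \<open>
  A Moebius transformation is given by an invertible matrix representing it, which acts on the
  homogeneous coordinates of the target when composed with a map.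
\<close>

definition moebius_map :: "complex^2^2 \<Rightarrow> cp1 \<Rightarrow> cp1" where
  "moebius_map A x = abs_cp1 (A *v rep_cp1 x)"

definition moebius_comp :: "complex^2^2 \<Rightarrow> form_pair \<Rightarrow> form_pair" where
  "moebius_comp A \<Phi> =
     (Polynomial.smult [:A $ 1 $ 1:] (fst \<Phi>) + Polynomial.smult [:A $ 1 $ 2:] (snd \<Phi>),
      Polynomial.smult [:A $ 2 $ 1:] (fst \<Phi>) + Polynomial.smult [:A $ 2 $ 2:] (snd \<Phi>))"

definition weakly_converges :: "(nat \<Rightarrow> cp1 measure) \<Rightarrow> cp1 measure \<Rightarrow> bool" where
  "weakly_converges \<mu> \<nu> \<longleftrightarrow>
     (\<forall>\<psi> :: cp1 \<Rightarrow> real. continuous_on UNIV \<psi> \<longrightarrow>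
        (\<lambda>k. \<integral>x. \<psi> x \<partial>(\<mu> k)) \<longlonglongrightarrow> (\<integral>x. \<psi> x \<partial>\<nu>))"

definition A_weakly_converges ::
    "(nat \<Rightarrow> complex^2^2) \<Rightarrow> (nat \<Rightarrow> cp1 measure) \<Rightarrow> cp1 measure \<Rightarrow> cp1 measure \<Rightarrow> bool" where
  "A_weakly_converges A \<mu> \<mu>\<^sub>C \<mu>\<^sub>E \<longleftrightarrow> borel_prob \<mu>\<^sub>C \<and> borel_prob \<mu>\<^sub>E \<and>
     weakly_converges \<mu> \<mu>\<^sub>C \<and> weakly_converges (\<lambda>k. distr (\<mu> k) borel (moebius_map (A k))) \<mu>\<^sub>E"

definition A_weak_limit ::
    "(nat \<Rightarrow> complex^2^2) \<Rightarrow> (nat \<Rightarrow> cp1 measure) \<Rightarrow> cp1 measure \<Rightarrow> cp1 measure \<Rightarrow> bool" where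
  "A_weak_limit A \<mu> \<mu>\<^sub>C \<mu>\<^sub>E \<longleftrightarrow>
     (\<exists>r. strict_mono r \<and> A_weakly_converges (A \<circ> r) (\<mu> \<circ> r) \<mu>\<^sub>C \<mu>\<^sub>E)"

end

theory Submission
  imports Defs
begin

text \<open>
  Write a point of the target as $y = (a : b)$. For coprime $P$ and $Q$ the preimages of $y$ under
  $(P : Q)$, counted with multiplicity, are the zeros of the binary form $b P - a Q$, a member of
  the pencil spanned by $P$ and $Q$. For a form $F$ let \<open>root_sum F \<psi>\<close> be the sum of \<open>\<psi>\<close> over the zeros of $F$ with
  multiplicity. For a reduced nonconstant map \<open>\<phi>\<close> the sum over the zeros of $b p - a q$ is
  \<open>\<phi>\<^sub>*\<psi>(y)\<close>. For $\Phi = (H p, H q)$ the form $b P - a Q = H \cdot (b p - a q)$ has in addition the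
  zeros of $H$, so the sum over its zeros is \<open>\<phi>\<^sub>*\<psi>(y) + \<Sum>\<^sub>x s(x) \<psi>(x)\<close>: the integral of this
  function of $y$ against \<open>\<mu>\<^sub>E\<close> is the integral of \<open>\<psi>\<close> against the paired pullback. The surplus
  multiplicities therefore appear automatically once forms are kept unreduced.

  Put $g_k = A_k \circ f_k$ and $\nu_k = (A_k)_* \mu_{f_k}$. Since $f_k^* \mu_{f_k} = g_k^* \nu_k$,
  the equation $f_k^* \mu_{f_k} = d \mu_{f_k}$ says that $d \int \psi \, d\mu_{f_k}$ is the integral
  against $\nu_k$ of the sum of \<open>\<psi>\<close> over the zeros of the pencil members of $g_k$. The zeros of a
  nonzero form of degree $d$ depend continuously on the form, and no member of the pencil of $\Phi$
  vanishes identically because \<open>\<phi>\<close> is nonconstant. As the projective line is compact, the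
  integrands converge uniformly in $y$ to the continuous function attached to $\Phi$, so
  both sides pass to the limit and give $d \int \psi \, d\mu_C = \int \psi \, d\Phi^*(\mu_C, \mu_E)$
  for every continuous \<open>\<psi>\<close>. A finite Borel measure on the projective line is determined by such
  integrals.

  Four ingredients carry the argument. Continuity of zeros (\<open>root_sum_tendsto\<close>) comes from
  factoring forms into linear forms with unit coefficient vectors and extracting convergent
  subsequences of these vectors. Uniformity is \<open>root_sum_pencil_uniform\<close>. That the pullback of a
  measure exists and is unique (\<open>pullback_measure_characterization\<close>) is shown by integrating the
  kernel that sends $y$ to the uniform distribution on its preimages. Convergence in the quotient
  space of pairs up to scaling yields scalars for which the coefficients converge
  (\<open>RatBar_limit_representatives\<close>).
\<close>

unbundle no fps_syntax
no_notation vec_index (infixl "$" 100)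
no_notation fps_nth (infixl "$" 75)

section \<open>Points, compactness and test functions on the projective line\<close>

lemma vec2_eq_iff: "v = w \<longleftrightarrow> v $ 1 = w $ 1 \<and> v $ 2 = (w :: 'a^2) $ 2"
  by (auto simp: Finite_Cartesian_Product.vec_eq_iff forall_2)

lemma rep_cp1_nonzero [simp]: "rep_cp1 x \<noteq> 0"
  using Quotient_rep_reflp[OF Quotient_cp1, of x] by (simp add: proportional_def)

lemma abs_rep_cp1 [simp]: "abs_cp1 (rep_cp1 x) = x"
  by (rule Quotient_abs_rep[OF Quotient_cp1])

lemma abs_cp1_eq_iff_proportional:
  assumes "v \<noteq> 0" "w \<noteq> 0"
  shows "abs_cp1 v = abs_cp1 w \<longleftrightarrow> (\<exists>c. c \<noteq> 0 \<and> w = c *s v)"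
proof -
  have "proportional u u" if "u \<noteq> 0" for u
    using that by (auto simp: proportional_def intro!: exI[of _ 1])
  then show ?thesis
    using Quotient_rel[OF Quotient_cp1, of v w] assms by (auto simp: proportional_def)
qed

lemma abs_cp1_eq_iff:
  assumes "v \<noteq> 0" "w \<noteq> 0"
  shows "abs_cp1 v = abs_cp1 w \<longleftrightarrow> v $ 1 * w $ 2 = v $ 2 * w $ 1"
proof -
  have *: "(\<exists>c. c \<noteq> 0 \<and> w = c *s v)" if e: "v $ 1 * w $ 2 = v $ 2 * w $ 1"
  proof (cases "v $ 1 = 0")
    case True
    with assms have v2: "v $ 2 \<noteq> 0" by (auto simp: vec2_eq_iff)
    with e True have w1: "w $ 1 = 0" by simp
    with assms have "w $ 2 \<noteq> 0" by (auto simp: vec2_eq_iff)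
    with v2 w1 True show ?thesis
      by (intro exI[of _ "w $ 2 / v $ 2"]) (simp add: vec2_eq_iff)
  next
    case False
    have "w $ 1 \<noteq> 0"
    proof
      assume "w $ 1 = 0"
      with e False have "w $ 2 = 0" by simp
      with \<open>w $ 1 = 0\<close> assms show False by (auto simp: vec2_eq_iff)
    qed
    with e False show ?thesis
      by (intro exI[of _ "w $ 1 / v $ 1"]) (auto simp: vec2_eq_iff field_simps)
  qed
  then show ?thesis
    unfolding abs_cp1_eq_iff_proportional[OF assms] by auto
qed

lemma abs_cp1_scale [simp]:
  assumes "v \<noteq> 0" "c \<noteq> 0"
  shows "abs_cp1 (c *s v) = abs_cp1 v"
proof -
  have "c *s v \<noteq> 0" using assms by (auto simp: vec2_eq_iff)
  with assms show ?thesis by (simp add: abs_cp1_eq_iff)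
qed

lemma rep_abs_cp1:
  assumes "v \<noteq> 0"
  obtains c where "c \<noteq> 0" "rep_cp1 (abs_cp1 v) = c *s v"
  using abs_cp1_eq_iff_proportional[OF assms rep_cp1_nonzero[of "abs_cp1 v"]] by auto

lemma norm_vector_scale: "norm (c *s v) = cmod c * norm (v :: complex^2)"
proof -
  have "norm (c *s v) = sqrt ((cmod c)\<^sup>2 * ((cmod (v$1))\<^sup>2 + (cmod (v$2))\<^sup>2))"
    by (simp add: norm_vec_def L2_set_def sum_2 norm_mult power_mult_distrib algebra_simps)
  also have "\<dots> = cmod c * norm v"
    by (simp add: norm_vec_def L2_set_def sum_2 real_sqrt_mult)
  finally show ?thesis .
qed

definition normalize_vec :: "complex^2 \<Rightarrow> complex^2" where
  "normalize_vec v = of_real (inverse (norm v)) *s v"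

text \<open>
  Every point has a representative on the unit sphere, which is compact; all compactness arguments
  on the projective line are carried out there.
\<close>

definition unit_rep :: "cp1 \<Rightarrow> complex^2" where
  "unit_rep x = normalize_vec (rep_cp1 x)"

lemma norm_normalize_vec: "v \<noteq> 0 \<Longrightarrow> norm (normalize_vec v) = 1"
  by (simp add: normalize_vec_def norm_vector_scale norm_inverse)

lemma normalize_vec_nonzero: "v \<noteq> 0 \<Longrightarrow> normalize_vec v \<noteq> 0"
  using norm_normalize_vec by fastforce

lemma abs_normalize_vec [simp]: "v \<noteq> 0 \<Longrightarrow> abs_cp1 (normalize_vec v) = abs_cp1 v"
  by (simp add: normalize_vec_def)

lemma norm_unit_rep [simp]: "norm (unit_rep x) = 1"
  by (simp add: unit_rep_def norm_normalize_vec)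

lemma unit_rep_nonzero [simp]: "unit_rep x \<noteq> 0"
  by (simp add: unit_rep_def normalize_vec_nonzero)

lemma abs_unit_rep [simp]: "abs_cp1 (unit_rep x) = x"
  by (simp add: unit_rep_def)

lemma continuous_on_normalize_vec: "continuous_on (- {0}) normalize_vec"
proof -
  have eq: "normalize_vec = (\<lambda>v. \<chi> i. of_real (inverse (norm v)) * v $ i)"
    by (auto simp: normalize_vec_def vec2_eq_iff)
  show ?thesis
    unfolding eq by (auto intro!: continuous_intros)
qed

text \<open>
  The topology of the projective line is the quotient topology, so continuity can be tested on
  homogeneous coordinates.
\<close>

lemma continuous_on_cp1_iff:
  fixes g :: "cp1 \<Rightarrow> 'b::topological_space"
  shows "continuous_on UNIV g \<longleftrightarrow> continuous_on (- {0}) (\<lambda>v. g (abs_cp1 v))"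
proof -
  have "open (g -` B) \<longleftrightarrow> open ((\<lambda>v. g (abs_cp1 v)) -` B \<inter> - {0})" for B
    unfolding open_cp1_def by (rule arg_cong[where f = "open"]) auto
  then show ?thesis
    by (simp add: continuous_on_open_vimage[OF open_UNIV]
        continuous_on_open_vimage[OF open_Compl[OF closed_singleton]])
qed

lemma continuous_on_abs_cp1: "continuous_on (- {0}) abs_cp1"
  using continuous_on_cp1_iff[of "\<lambda>x. x"] by simp

lemma tendsto_cp1:
  fixes \<psi> :: "cp1 \<Rightarrow> 'b::topological_space"
  assumes "continuous_on UNIV \<psi>" "(\<lambda>k. u k) \<longlonglongrightarrow> w" "w \<noteq> 0" "\<And>k. u k \<noteq> 0"
  shows "(\<lambda>k. \<psi> (abs_cp1 (u k))) \<longlonglongrightarrow> \<psi> (abs_cp1 w)"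
  using assms by (intro continuous_on_tendsto_compose[OF assms(1)[unfolded continuous_on_cp1_iff] assms(2)]) auto

lemma continuous_cp1_bounded:
  fixes \<psi> :: "cp1 \<Rightarrow> real"
  assumes "continuous_on UNIV \<psi>"
  obtains B where "\<And>x. \<bar>\<psi> x\<bar> \<le> B"
proof -
  have "compact ((\<lambda>v. \<psi> (abs_cp1 v)) ` sphere (0::complex^2) 1)"
    using assms unfolding continuous_on_cp1_iff
    by (intro compact_continuous_image) (auto elim: continuous_on_subset)
  from compact_imp_bounded[OF this] obtain B where
    B: "\<And>v. v \<in> sphere (0::complex^2) 1 \<Longrightarrow> \<bar>\<psi> (abs_cp1 v)\<bar> \<le> B"
    by (fastforce simp: bounded_iff)
  show ?thesis
    by (rule that[of B]) (use B[of "unit_rep _"] in simp)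
qed

text \<open>
  The function is the distance from a unit representative of $x$ to the set $C$ of all unit vectors
  representing points outside $A$. Two unit representatives of a point differ by a unit complex
  scalar. Such a scalar acts isometrically and maps $C$ to itself, so the distance does not depend
  on the representative. It vanishes only on $C$ because $C$ is closed.
\<close>

lemma open_cp1_bump:
  assumes "open A" "A \<noteq> (UNIV :: cp1 set)"
  obtains g :: "cp1 \<Rightarrow> real" where "continuous_on UNIV g" "\<And>x. 0 \<le> g x" "\<And>x. g x > 0 \<longleftrightarrow> x \<in> A"
proof -
  define C where "C = sphere (0::complex^2) 1 - {v. v \<noteq> 0 \<and> abs_cp1 v \<in> A}"
  have C_iff: "v \<in> C \<longleftrightarrow> norm v = 1 \<and> abs_cp1 v \<notin> A" for v by (auto simp: C_def)
  have "closed C"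
    using assms(1) unfolding C_def open_cp1_def by (intro closed_Diff) auto
  have "C \<noteq> {}"
  proof -
    from assms obtain x where "x \<notin> A" by auto
    then have "unit_rep x \<in> C" by (simp add: C_iff)
    then show ?thesis by auto
  qed
  have le: "infdist (c *s v) C \<le> infdist v C" if c: "cmod c = 1" for c v
  proof -
    obtain a where a: "a \<in> C" "infdist v C = dist v a"
      using infdist_attains_inf[OF \<open>closed C\<close> \<open>C \<noteq> {}\<close>] by metis
    have "a \<noteq> 0" using a by (auto simp: C_iff)
    then have "c *s a \<in> C" using a c by (cases "c = 0") (auto simp: C_iff norm_vector_scale)
    then have "infdist (c *s v) C \<le> dist (c *s v) (c *s a)" by (rule infdist_le)
    also have "\<dots> = norm (c *s (v - a))"
      unfolding dist_norm by (rule arg_cong[where f = norm]) (simp add: vec2_eq_iff algebra_simps)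
    also have "\<dots> = infdist v C" unfolding a norm_vector_scale dist_norm using c by simp
    finally show ?thesis .
  qed
  have inv: "infdist (c *s v) C = infdist v C" if c: "cmod c = 1" for c v
  proof (rule antisym[OF le[OF c]])
    have "c \<noteq> 0" using c by auto
    then have "v = inverse c *s (c *s v)" by (simp add: vec_eq_iff)
    moreover have "cmod (inverse c) = 1" using c by (simp add: norm_inverse)
    ultimately show "infdist v C \<le> infdist (c *s v) C" using le[of "inverse c" "c *s v"] by simp
  qed
  define g where "g x = infdist (unit_rep x) C" for x
  have g_abs: "g (abs_cp1 v) = infdist (normalize_vec v) C" if v: "v \<noteq> 0" for v
  proof -
    obtain c where c: "c \<noteq> 0" "unit_rep (abs_cp1 v) = c *s normalize_vec v"
      using abs_cp1_eq_iff_proportional[of "normalize_vec v" "unit_rep (abs_cp1 v)"] v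
      by (auto simp: normalize_vec_nonzero)
    have "1 = cmod c * 1"
      using arg_cong[OF c(2), of norm] v by (simp add: norm_vector_scale norm_normalize_vec)
    then have "cmod c = 1" by simp
    then show ?thesis by (simp add: g_def c(2) inv)
  qed
  have "continuous_on (- {0}) (\<lambda>v. g (abs_cp1 v))"
    using continuous_on_infdist[OF continuous_on_normalize_vec, of C]
    by (rule continuous_on_cong[THEN iffD1, rotated 2]) (auto simp: g_abs)
  then have "continuous_on UNIV g" by (simp add: continuous_on_cp1_iff)
  moreover have "g x > 0 \<longleftrightarrow> x \<in> A" for x
    using in_closed_iff_infdist_zero[OF \<open>closed C\<close> \<open>C \<noteq> {}\<close>, of "unit_rep x"]
      infdist_nonneg[of "unit_rep x" C]
    by (auto simp: g_def C_iff)
  ultimately show ?thesis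
    by (intro that[of g]) (auto simp: g_def infdist_nonneg)
qed

text \<open>
  With $g$ as in \<open>open_cp1_bump\<close>, the functions $\min(1, n g)$ increase to the indicator of $A$. This
  is the only link needed between Borel measures and continuous test functions.
\<close>

lemma open_cp1_indicator_limit:
  assumes "open (A :: cp1 set)"
  obtains \<psi> :: "nat \<Rightarrow> cp1 \<Rightarrow> real"
  where "\<And>n. continuous_on UNIV (\<psi> n)" "\<And>n x. 0 \<le> \<psi> n x" "\<And>n x. \<psi> n x \<le> 1"
    "\<And>x. (\<lambda>n. \<psi> n x) \<longlonglongrightarrow> indicator A x"
proof (cases "A = UNIV")
  case True
  then show ?thesis by (intro that[of "\<lambda>_ _. 1"]) auto
next
  case False
  obtain g :: "cp1 \<Rightarrow> real" where g: "continuous_on UNIV g" "\<And>x. 0 \<le> g x" "\<And>x. g x > 0 \<longleftrightarrow> x \<in> A"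
    using open_cp1_bump[OF assms False] by blast
  define \<psi> where "\<psi> n x = min 1 (real n * g x)" for n x
  have "(\<lambda>n. \<psi> n x) \<longlonglongrightarrow> indicator A x" for x
  proof (cases "x \<in> A")
    case True
    then have gx: "g x > 0" by (simp add: g)
    obtain N where N: "1 / g x < real N" using reals_Archimedean2 by blast
    have "\<psi> n x = 1" if "n \<ge> N" for n
    proof -
      have "1 / g x \<le> real n" using N that by linarith
      then show ?thesis using gx by (simp add: \<psi>_def field_simps)
    qed
    then show ?thesis using True
      by (intro tendsto_eventually) (auto simp: eventually_sequentially)
  next
    case False
    then have "g x = 0" using g(2,3)[of x] by force
    with False show ?thesis by (simp add: \<psi>_def)
  qed
  then show ?thesis
    using g by (intro that[of \<psi>]) (auto simp: \<psi>_def intro!: continuous_intros)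
qed

section \<open>Binary forms and their zeros\<close>

text \<open>
  Scalars enter as constant polynomials in the second variable, since the coefficients of a
  form are themselves polynomials.
\<close>

abbreviation cmul :: "complex \<Rightarrow> bipoly \<Rightarrow> bipoly" where
  "cmul c F \<equiv> Polynomial.smult [:c:] F"

text \<open>
  The linear form that vanishes exactly at the point represented by $v$. Unlike \<^const>\<open>point_form\<close>
  it refers to a vector, so that it varies continuously.
\<close>

definition linear_form :: "complex^2 \<Rightarrow> bipoly" where
  "linear_form v = [: [:0, - (v $ 1):], [:v $ 2:] :]"

lemma point_form_eq_linear_form: "point_form x = linear_form (rep_cp1 x)"
  by (simp add: point_form_def linear_form_def)

lemma linear_form_scale: "linear_form (c *s v) = cmul c (linear_form v)"
  by (simp add: linear_form_def)

lemma homogeneous_0 [simp]: "homogeneous d 0"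
  by (simp add: homogeneous_def)

lemma homogeneous_linear_form: "homogeneous 1 (linear_form v)"
  by (auto simp: homogeneous_def linear_form_def coeff_pCons split: nat.splits)

lemma homogeneous_const: "homogeneous 0 [:[:c:]:]"
  by (auto simp: homogeneous_def coeff_pCons split: nat.splits)

lemma homogeneous_add: "homogeneous d F \<Longrightarrow> homogeneous d G \<Longrightarrow> homogeneous d (F + G)"
  unfolding homogeneous_def by (metis add.right_neutral coeff_add)

lemma homogeneous_cmul: "homogeneous d F \<Longrightarrow> homogeneous d (cmul c F)"
  by (auto simp: homogeneous_def)

lemma homogeneous_diff: "homogeneous d F \<Longrightarrow> homogeneous d G \<Longrightarrow> homogeneous d (F - G)"
  unfolding homogeneous_def by (metis coeff_diff diff_0 diff_0_right neg_0_equal_iff_equal)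

lemma homogeneous_mult:
  assumes "homogeneous d F" "homogeneous e G"
  shows "homogeneous (d + e) (F * G)"
  unfolding homogeneous_def
proof (intro allI impI)
  fix i j assume "coeff (coeff (F * G) i) j \<noteq> 0"
  also have "coeff (coeff (F * G) i) j =
      (\<Sum>k\<le>i. \<Sum>l\<le>j. coeff (coeff F k) l * coeff (coeff G (i - k)) (j - l))"
    by (simp add: coeff_mult coeff_sum)
  finally obtain k where k: "k \<le> i"
      "(\<Sum>l\<le>j. coeff (coeff F k) l * coeff (coeff G (i - k)) (j - l)) \<noteq> 0"
    by (metis (mono_tags, lifting) atMost_iff sum.neutral)
  then obtain l where "l \<le> j" "coeff (coeff F k) l * coeff (coeff G (i - k)) (j - l) \<noteq> 0"
    by (metis (mono_tags, lifting) atMost_iff sum.neutral)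
  with k(1) assms show "i + j = d + e"
    unfolding homogeneous_def by fastforce
qed

lemma homogeneous_prod_linear_form:
  "finite I \<Longrightarrow> homogeneous (card I) (\<Prod>i\<in>I. linear_form (v i))"
proof (induction I rule: finite_induct)
  case empty
  then show ?case using homogeneous_const[of 1] by (simp add: one_pCons)
next
  case (insert i I)
  then show ?case using homogeneous_mult[OF homogeneous_linear_form, of "card I" _ "v i"] by simp
qed

lemma homogeneous_degree_unique:
  assumes "homogeneous d F" "homogeneous e F" "F \<noteq> 0"
  shows "d = e"
proof -
  have "coeff (coeff F (degree F)) (degree (coeff F (degree F))) \<noteq> 0" using assms(3) by simp
  then show ?thesis using assms(1,2) unfolding homogeneous_def by metis
qed

lemma eval_form_mult [simp]: "eval_form (F * G) v = eval_form F v * eval_form G v"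
  and eval_form_add [simp]: "eval_form (F + G) v = eval_form F v + eval_form G v"
  and eval_form_diff [simp]: "eval_form (F - G) v = eval_form F v - eval_form G v"
  and eval_form_cmul [simp]: "eval_form (cmul c F) v = c * eval_form F v"
  and eval_form_0 [simp]: "eval_form 0 v = 0"
  and eval_form_1 [simp]: "eval_form 1 v = 1"
  and eval_form_linear_form: "eval_form (linear_form u) v = u $ 2 * v $ 1 - u $ 1 * v $ 2"
  by (simp_all add: eval_form_def linear_form_def algebra_simps)

lemma eval_form_prod: "eval_form (\<Prod>i\<in>I. F i) v = (\<Prod>i\<in>I. eval_form (F i) v)"
  by (induction I rule: infinite_finite_induct) simp_all

text \<open>
  A form of degree $d$ is determined by the numbers multiplying $z^i w^{d-i}$: every coefficient
  is a single monomial in $w$.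
\<close>

lemma coeff_form:
  assumes "homogeneous d F"
  shows "coeff F i = (if i \<le> d then monom (coeff (coeff F i) (d - i)) (d - i) else 0)"
proof (rule poly_eqI)
  fix j
  show "coeff (coeff F i) j =
      coeff (if i \<le> d then monom (coeff (coeff F i) (d - i)) (d - i) else 0) j"
    using assms unfolding homogeneous_def by (cases "coeff (coeff F i) j = 0") fastforce+
qed

lemma eval_form_homogeneous:
  assumes "homogeneous d F"
  shows "eval_form F v = (\<Sum>i\<le>d. coeff (coeff F i) (d - i) * (v $ 1) ^ i * (v $ 2) ^ (d - i))"
proof -
  have deg: "degree F \<le> d"
    by (intro degree_le) (subst coeff_form[OF assms], simp)
  have "eval_form F v = (\<Sum>i\<le>degree F. poly (coeff F i) (v $ 2) * (v $ 1) ^ i)"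
    unfolding eval_form_def by (subst poly_altdef) (simp add: poly_sum poly_power)
  also have "\<dots> = (\<Sum>i\<le>d. poly (coeff F i) (v $ 2) * (v $ 1) ^ i)"
    using deg by (intro sum.mono_neutral_left) (auto simp: coeff_eq_0)
  also have "\<dots> = (\<Sum>i\<le>d. coeff (coeff F i) (d - i) * (v $ 1) ^ i * (v $ 2) ^ (d - i))"
    by (intro sum.cong refl) (subst coeff_form[OF assms], simp add: poly_monom)
  finally show ?thesis .
qed

definition dehomogenize :: "nat \<Rightarrow> bipoly \<Rightarrow> complex poly" where
  "dehomogenize d F = (\<Sum>i\<le>d. monom (coeff (coeff F i) (d - i)) i)"

lemma poly_dehomogenize:
  assumes "homogeneous d F"
  shows "poly (dehomogenize d F) z = eval_form F (vector [z, 1])"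
  by (simp add: eval_form_homogeneous[OF assms] dehomogenize_def poly_sum poly_monom)

lemma coeff_dehomogenize:
  "coeff (dehomogenize d F) i = (if i \<le> d then coeff (coeff F i) (d - i) else 0)"
  by (simp add: dehomogenize_def coeff_sum)

text \<open>
  A form of known degree can be recovered from its dehomogenization at $w = 1$, which has the same
  coefficients.
\<close>

lemma form_eqI:
  assumes "homogeneous d F" "homogeneous d G"
    and "\<And>z. eval_form F (vector [z, 1]) = eval_form G (vector [z, 1])"
  shows "F = G"
proof -
  have "poly (dehomogenize d F) = poly (dehomogenize d G)"
    using assms by (auto simp: poly_dehomogenize)
  then have "dehomogenize d F = dehomogenize d G" by (simp add: poly_eq_poly_eq_iff)
  then have "coeff (coeff F i) (d - i) = coeff (coeff G i) (d - i)" if "i \<le> d" for i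
    using that coeff_dehomogenize[of d F i] coeff_dehomogenize[of d G i] by simp
  then show ?thesis
    by (intro poly_eqI[of F G]) (subst coeff_form[OF assms(1)], subst coeff_form[OF assms(2)], simp)
qed

lemma degree_dehomogenize: "degree (dehomogenize d F) \<le> d"
  by (intro degree_le) (auto simp: coeff_dehomogenize)

text \<open>
  The dehomogenization splits by the fundamental theorem of algebra. Its degree may be less than
  $d$; each missing root is a zero of the form at the point $(1 : 0)$. Normalizing the
  vectors confines the zeros to a compact set.
\<close>

lemma form_factorization:
  assumes F: "homogeneous d F" and "F \<noteq> 0"
  obtains c v where "c \<noteq> 0" "\<And>i. norm (v i) = 1" "F = cmul c (\<Prod>i<d. linear_form (v i))"
proof -
  define f where "f = dehomogenize d F"
  obtain root where root: "Polynomial.smult (lead_coeff f) (\<Prod>i<degree f. [:-root i, 1:]) = f"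
    by (rule complex_poly_decompose')
  define n where "n = degree f"
  have n: "n \<le> d" by (simp add: n_def f_def degree_dehomogenize)
  \<comment> \<open>the roots that the dehomogenization lacks are placed at $(1 : 0)$; the sign gives the factor $w$\<close>
  define u :: "nat \<Rightarrow> complex^2" where "u i = (if i < n then vector [root i, 1] else vector [-1, 0])" for i
  have u0: "u i \<noteq> 0" for i by (simp add: u_def vec2_eq_iff)
  define G where "G = cmul (lead_coeff f) (\<Prod>i<d. linear_form (u i))"
  have "homogeneous d G"
    unfolding G_def using homogeneous_prod_linear_form[of "{..<d}" u] by (intro homogeneous_cmul) simp
  have "F = G"
  proof (rule form_eqI[OF F \<open>homogeneous d G\<close>])
    fix z
    have "(\<Prod>i<d. eval_form (linear_form (u i)) (vector [z, 1])) = (\<Prod>i<n. z - root i)"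
      using n by (intro prod.mono_neutral_cong_right) (auto simp: eval_form_linear_form u_def)
    then have "eval_form G (vector [z, 1]) = lead_coeff f * (\<Prod>i<n. z - root i)"
      by (simp add: G_def eval_form_prod)
    also have "\<dots> = poly f z"
      by (subst (2) root[symmetric]) (simp add: n_def poly_prod)
    finally show "eval_form F (vector [z, 1]) = eval_form G (vector [z, 1])"
      by (simp add: f_def poly_dehomogenize[OF F])
  qed
  define c where "c = lead_coeff f * (\<Prod>i<d. of_real (norm (u i)))"
  have u_eq: "linear_form (u i) = cmul (of_real (norm (u i))) (linear_form (normalize_vec (u i)))" for i
    using u0[of i] by (simp add: linear_form_scale[symmetric] normalize_vec_def)
  have const_prod: "(\<Prod>i\<in>I. [:g i:]) = [:\<Prod>i\<in>I. g i:]" for g :: "nat \<Rightarrow> complex" and I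
    by (induction I rule: infinite_finite_induct) (simp_all add: one_pCons)
  have "G = cmul c (\<Prod>i<d. linear_form (normalize_vec (u i)))"
    unfolding G_def u_eq prod_smult const_prod by (simp add: c_def mult.commute)
  moreover from this \<open>F = G\<close> \<open>F \<noteq> 0\<close> have "c \<noteq> 0" by auto
  ultimately show ?thesis
    using \<open>F = G\<close> u0 by (intro that[of c "\<lambda>i. normalize_vec (u i)"]) (auto simp: norm_normalize_vec)
qed

text \<open>
  Primality makes \<^const>\<open>ord_at\<close> additive on products. For a vector with nonzero second coordinate,
  the form is a polynomial of degree one in $z$ with coprime coefficients; otherwise it is a
  constant multiple of $w$.
\<close>

lemma prime_elem_linear_form:
  assumes "v \<noteq> 0"
  shows "prime_elem (linear_form v)"
proof (cases "v $ 2 = 0")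
  case True
  with assms have "v $ 1 \<noteq> 0" by (auto simp: vec2_eq_iff)
  with True show ?thesis
    by (simp add: linear_form_def prime_elem_const_poly_iff prime_elem_linear_field_poly)
next
  case False
  then have "is_unit [:v $ 2:]" by (simp add: is_unit_const_poly_iff)
  then show ?thesis unfolding linear_form_def
    using False by (intro prime_elem_linear_poly) (auto intro: is_unit_right_imp_coprime)
qed

lemma linear_form_nonzero: "v \<noteq> 0 \<Longrightarrow> linear_form v \<noteq> 0"
  using prime_elem_linear_form[of v] by auto

lemma is_unit_const: "c \<noteq> 0 \<Longrightarrow> is_unit [:[:c:]:]" for c :: complex
  by (simp add: is_unit_const_poly_iff)

lemma cmul_eq: "cmul c F = [:[:c:]:] * F"
  by simp

lemma ord_at_cmul: "c \<noteq> 0 \<Longrightarrow> ord_at x (cmul c F) = ord_at x F"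
  unfolding ord_at_def cmul_eq by (intro multiplicity_times_unit_right is_unit_const)

lemma ord_at_0 [simp]: "ord_at x 0 = 0"
  by (simp add: ord_at_def)

lemma ord_at_linear_form:
  assumes "v \<noteq> 0"
  shows "ord_at x (linear_form v) = of_bool (abs_cp1 v = x)"
proof (cases "abs_cp1 v = x")
  case True
  then obtain c where c: "c \<noteq> 0" "rep_cp1 x = c *s v" using rep_abs_cp1[OF assms] by metis
  have "ord_at x (linear_form v) = multiplicity (linear_form v) (linear_form v)"
    unfolding ord_at_def point_form_eq_linear_form c linear_form_scale cmul_eq
    by (intro multiplicity_times_unit_left is_unit_const c)
  also have "\<dots> = 1" using prime_elem_linear_form[OF assms] by (intro multiplicity_self) auto
  finally show ?thesis using True by simp
next
  case False
  have "\<not> point_form x dvd linear_form v"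
  proof
    assume "point_form x dvd linear_form v"
    then obtain G where "linear_form v = linear_form (rep_cp1 x) * G" by (auto simp: point_form_eq_linear_form elim: dvdE)
    then have "eval_form (linear_form v) (rep_cp1 x) = 0" by (simp add: eval_form_linear_form)
    then have "abs_cp1 v = abs_cp1 (rep_cp1 x)"
      using assms by (subst abs_cp1_eq_iff) (auto simp: eval_form_linear_form mult.commute)
    with False show False by simp
  qed
  with False show ?thesis by (simp add: ord_at_def not_dvd_imp_multiplicity_0)
qed

lemma ord_at_mult:
  "F \<noteq> 0 \<Longrightarrow> G \<noteq> 0 \<Longrightarrow> ord_at x (F * G) = ord_at x F + ord_at x G"
  unfolding ord_at_def point_form_eq_linear_form
  by (intro prime_elem_multiplicity_mult_distrib prime_elem_linear_form rep_cp1_nonzero)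

lemma ord_at_factored:
  fixes d :: nat
  assumes "c \<noteq> 0" "\<And>i. i < d \<Longrightarrow> v i \<noteq> 0"
  shows "ord_at x (cmul c (\<Prod>i<d. linear_form (v i))) = card {i. i < d \<and> abs_cp1 (v i) = x}"
proof -
  have "0 \<notin> (\<lambda>i. linear_form (v i)) ` {..<d}" using assms(2) linear_form_nonzero by force
  then have "ord_at x (\<Prod>i<d. linear_form (v i)) = (\<Sum>i<d. ord_at x (linear_form (v i)))"
    unfolding ord_at_def point_form_eq_linear_form
    by (intro prime_elem_multiplicity_prod_distrib prime_elem_linear_form) auto
  also have "\<dots> = (\<Sum>i<d. of_bool (abs_cp1 (v i) = x))"
    using assms(2) by (intro sum.cong) (auto simp: ord_at_linear_form)
  also have "\<dots> = card ({..<d} \<inter> {i. abs_cp1 (v i) = x})"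
    by (subst sum_of_bool_eq) (auto simp: Int_def)
  finally show ?thesis using assms(1) by (simp add: ord_at_cmul Int_def)
qed

lemma ord_at_nonzero_iff:
  assumes F: "homogeneous d F" "F \<noteq> 0"
  shows "ord_at x F \<noteq> 0 \<longleftrightarrow> eval_form F (rep_cp1 x) = 0"
proof -
  obtain c v where cv: "c \<noteq> 0" "\<And>i. norm (v i) = 1" "F = cmul c (\<Prod>i<d. linear_form (v i))"
    using form_factorization[OF F] by metis
  have v0: "v i \<noteq> 0" for i using cv(2)[of i] by auto
  have "abs_cp1 (v i) = x \<longleftrightarrow> eval_form (linear_form (v i)) (rep_cp1 x) = 0" for i
    using abs_cp1_eq_iff[OF v0[of i] rep_cp1_nonzero[of x]] by (auto simp: eval_form_linear_form mult.commute)
  then show ?thesis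
    using cv(1) v0 by (auto simp: cv(3) ord_at_factored eval_form_prod)
qed

definition root_sum :: "bipoly \<Rightarrow> (cp1 \<Rightarrow> real) \<Rightarrow> real" where
  "root_sum F \<psi> = (\<Sum>x | ord_at x F \<noteq> 0. real (ord_at x F) * \<psi> x)"

lemma root_sum_factored:
  fixes d :: nat
  assumes "c \<noteq> 0" "\<And>i. i < d \<Longrightarrow> v i \<noteq> 0" "F = cmul c (\<Prod>i<d. linear_form (v i))"
  shows "finite {x. ord_at x F \<noteq> 0}" "root_sum F \<psi> = (\<Sum>i<d. \<psi> (abs_cp1 (v i)))"
proof -
  have ord: "ord_at x F = card {i. i < d \<and> abs_cp1 (v i) = x}" for x
    using ord_at_factored[OF assms(1,2)] assms(3) by simp
  have set: "{x. ord_at x F \<noteq> 0} = (\<lambda>i. abs_cp1 (v i)) ` {..<d}"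
    by (auto simp: ord)
  show "finite {x. ord_at x F \<noteq> 0}" unfolding set by simp
  have "root_sum F \<psi> =
      (\<Sum>x\<in>(\<lambda>i. abs_cp1 (v i)) ` {..<d}. \<Sum>i | i \<in> {..<d} \<and> abs_cp1 (v i) = x. \<psi> (abs_cp1 (v i)))"
    unfolding root_sum_def set by (intro sum.cong refl) (auto simp: ord)
  also have "\<dots> = (\<Sum>i<d. \<psi> (abs_cp1 (v i)))"
    by (rule sum.image_gen[symmetric]) simp
  finally show "root_sum F \<psi> = (\<Sum>i<d. \<psi> (abs_cp1 (v i)))" .
qed

lemma finite_ord_at:
  assumes "homogeneous d F"
  shows "finite {x. ord_at x F \<noteq> 0}"
proof (cases "F = 0")
  case False
  obtain c v where cv: "c \<noteq> 0" "\<And>i. norm (v i) = 1" "F = cmul c (\<Prod>i<d. linear_form (v i))"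
    using form_factorization[OF assms False] by metis
  have v0: "v i \<noteq> 0" for i using cv(2)[of i] by auto
  show ?thesis by (rule root_sum_factored(1)[OF cv(1) _ cv(3)]) (rule v0)
qed simp

lemma root_sum_cmul: "c \<noteq> 0 \<Longrightarrow> root_sum (cmul c F) \<psi> = root_sum F \<psi>"
  by (simp add: root_sum_def ord_at_cmul)

lemma root_sum_mult:
  assumes "homogeneous d F" "F \<noteq> 0" "homogeneous e G" "G \<noteq> 0"
  shows "root_sum (F * G) \<psi> = root_sum F \<psi> + root_sum G \<psi>"
proof -
  define S where "S = {x. ord_at x F \<noteq> 0} \<union> {x. ord_at x G \<noteq> 0}"
  have fin: "finite S" using finite_ord_at assms by (auto simp: S_def)
  have *: "root_sum K \<psi> = (\<Sum>x\<in>S. real (ord_at x K) * \<psi> x)" if "{x. ord_at x K \<noteq> 0} \<subseteq> S" for K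
    unfolding root_sum_def using fin that by (intro sum.mono_neutral_left) auto
  have FG: "ord_at x (F * G) = ord_at x F + ord_at x G" for x using assms by (simp add: ord_at_mult)
  have "root_sum (F * G) \<psi> = (\<Sum>x\<in>S. real (ord_at x (F * G)) * \<psi> x)"
    by (rule *) (auto simp: FG S_def)
  also have "\<dots> = root_sum F \<psi> + root_sum G \<psi>"
    by (subst (1 2) *) (auto simp: FG S_def algebra_simps sum.distrib)
  finally show ?thesis .
qed

text \<open>
  By unique factorization a divisor of a product of linear forms is, up to a constant, a product of
  some of them. Only its homogeneity is recorded: it makes the common factor of $(P, Q)$, and hence
  the reduction, a form.
\<close>

lemma divisor_of_prod_linear_form:
  assumes "finite I" "\<And>i. i \<in> I \<Longrightarrow> v i \<noteq> 0" "H dvd (\<Prod>i\<in>I. linear_form (v i))"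
  shows "\<exists>e. homogeneous e H"
  using assms
proof (induction I arbitrary: H rule: finite_induct)
  case empty
  then have "is_unit H" by simp
  then obtain a where a: "H = [:a:]" "is_unit a" by (auto simp: is_unit_poly_iff)
  then obtain c where "a = [:c:]" by (auto elim: degree_eq_zeroE)
  then show ?case using a homogeneous_const by blast
next
  case (insert i I)
  have p: "prime_elem (linear_form (v i))" using insert.prems by (intro prime_elem_linear_form) simp
  show ?case
  proof (cases "linear_form (v i) dvd H")
    case True
    then obtain K where K: "H = linear_form (v i) * K" by (auto elim: dvdE)
    then have "linear_form (v i) * K dvd linear_form (v i) * (\<Prod>i\<in>I. linear_form (v i))" using insert by simp
    then have "K dvd (\<Prod>i\<in>I. linear_form (v i))" using p by (subst (asm) dvd_mult_cancel_left) auto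
    then obtain e where "homogeneous e K" using insert by auto
    then show ?thesis using homogeneous_mult[OF homogeneous_linear_form] K by blast
  next
    case False
    have "H dvd linear_form (v i) * (\<Prod>i\<in>I. linear_form (v i))" using insert by simp
    then obtain K where K: "linear_form (v i) * (\<Prod>i\<in>I. linear_form (v i)) = H * K" by (elim dvdE)
    then have "linear_form (v i) dvd H * K" by (metis dvd_triv_left)
    with False p have "linear_form (v i) dvd K" by (auto simp: prime_elem_dvd_mult_iff)
    then obtain L where "K = linear_form (v i) * L" by (auto elim: dvdE)
    with K have "linear_form (v i) * (\<Prod>i\<in>I. linear_form (v i)) = linear_form (v i) * (H * L)" by (simp add: ac_simps)
    then have "(\<Prod>i\<in>I. linear_form (v i)) = H * L" using p by auto
    then show ?thesis using insert by (intro insert.IH) auto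
  qed
qed

lemma divisor_of_form:
  assumes "homogeneous d F" "F \<noteq> 0" "H dvd F"
  shows "\<exists>e. homogeneous e H"
proof -
  obtain c v where cv: "c \<noteq> 0" "\<And>i. norm (v i) = 1" "F = cmul c (\<Prod>i<d. linear_form (v i))"
    using form_factorization[OF assms(1,2)] by metis
  have v0: "v i \<noteq> 0" for i using cv(2)[of i] by auto
  have "H dvd [:[:c:]:] * (\<Prod>i<d. linear_form (v i))" using assms(3) cv(3) by simp
  then have "H dvd (\<Prod>i<d. linear_form (v i))"
    using is_unit_const[OF cv(1)] by (simp only: dvd_mult_unit_iff')
  then show ?thesis using v0 by (intro divisor_of_prod_linear_form[of "{..<d}" v H]) auto
qed

lemma divisor_of_form_degree:
  assumes "homogeneous d (H * p)" "H * p \<noteq> 0" "homogeneous h H"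
  shows "h \<le> d \<and> homogeneous (d - h) p"
proof -
  obtain e where e: "homogeneous e p" using divisor_of_form[OF assms(1,2), of p] by auto
  then have "h + e = d"
    using homogeneous_degree_unique[OF homogeneous_mult[OF assms(3) e] assms(1,2)] by simp
  with e show ?thesis by auto
qed

section \<open>Continuity of the zeros of a form\<close>

text \<open>
  The usual subsequence principle: a sequence that stays away from $L$ infinitely often has a
  subsequence none of whose subsequences converges to $L$.
\<close>

lemma tendsto_if_subseq_tendsto:
  fixes X :: "nat \<Rightarrow> 'a::metric_space"
  assumes "\<And>r :: nat \<Rightarrow> nat. strict_mono r \<Longrightarrow> \<exists>s. strict_mono s \<and> (\<lambda>k. X (r (s k))) \<longlonglongrightarrow> L"
  shows "X \<longlonglongrightarrow> L"
proof (rule ccontr)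
  assume "\<not> X \<longlonglongrightarrow> L"
  then obtain e where e: "e > 0" "\<not> eventually (\<lambda>k. dist (X k) L < e) sequentially"
    by (auto simp: tendsto_iff)
  obtain r :: "nat \<Rightarrow> nat" where r: "strict_mono r" "\<And>k. \<not> dist (X (r k)) L < e"
    using not_eventually_sequentiallyD[OF e(2)] by auto
  obtain s where "(\<lambda>k. X (r (s k))) \<longlonglongrightarrow> L" using assms[OF r(1)] by auto
  then have "eventually (\<lambda>k. dist (X (r (s k))) L < e) sequentially"
    using e(1) by (auto simp: tendsto_iff)
  then show False using r(2) by (auto simp: eventually_sequentially)
qed

lemma unit_vectors_subseq:
  fixes u :: "nat \<Rightarrow> nat \<Rightarrow> complex^2"
  assumes "\<And>k i. norm (u k i) = 1"
  shows "\<exists>r w. strict_mono r \<and> (\<forall>i<n. (\<lambda>k. u (r k) i) \<longlonglongrightarrow> w i \<and> norm (w i) = 1)"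
proof (induction n)
  case 0
  then show ?case by (auto intro!: exI[of _ id] simp: strict_mono_id)
next
  case (Suc n)
  then obtain r w where r: "strict_mono r"
    and w: "\<forall>i<n. (\<lambda>k. u (r k) i) \<longlonglongrightarrow> w i \<and> norm (w i) = 1"
    by (elim exE conjE)
  have "compact (sphere (0::complex^2) 1)" by simp
  moreover have "\<forall>k. u (r k) n \<in> sphere 0 1" using assms by simp
  ultimately obtain l s where l: "l \<in> sphere 0 1" and s: "strict_mono s"
    and lim: "((\<lambda>k. u (r k) n) \<circ> s) \<longlonglongrightarrow> l"
    unfolding compact_def by (metis (no_types, lifting))
  have lim: "(\<lambda>k. u ((r \<circ> s) k) i) \<longlonglongrightarrow> (w(n := l)) i \<and> norm ((w(n := l)) i) = 1" if "i < Suc n" for i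
  proof (cases "i = n")
    case True
    with l lim show ?thesis by (simp add: o_def)
  next
    case False
    with that w have i: "(\<lambda>k. u (r k) i) \<longlonglongrightarrow> w i" "norm (w i) = 1" by simp_all
    from LIMSEQ_subseq_LIMSEQ[OF i(1) s] i(2) False show ?thesis by (simp add: o_def)
  qed
  have "strict_mono (r \<circ> s)" using r s by (rule strict_mono_o)
  then show ?case
    by (rule exI[of _ "r \<circ> s", OF exI[of _ "w(n := l)"], OF conjI])
      (intro allI impI lim)
qed

text \<open>
  Factor each $F_k$ as a constant $c_k$ times linear forms with unit vectors. Along a subsequence all
  $d$ vectors converge, and the product of the linear forms converges to a nonzero form $W$. At a
  point where $W$ does not vanish the values of $F_k$ then force $c_k$ to converge, so that $G$ is a
  multiple of $W$ and its zeros are the limits of the zeros of $F_k$. Since every subsequence has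
  such a further subsequence, the whole sequence converges.
\<close>

lemma root_sum_tendsto:
  fixes \<psi> :: "cp1 \<Rightarrow> real"
  assumes F: "\<And>k. homogeneous d (F k)" "\<And>k. F k \<noteq> 0"
    and G: "homogeneous d G" "G \<noteq> 0"
    and lim: "\<And>v. (\<lambda>k. eval_form (F k) v) \<longlonglongrightarrow> eval_form G v"
    and \<psi>: "continuous_on UNIV \<psi>"
  shows "(\<lambda>k. root_sum (F k) \<psi>) \<longlonglongrightarrow> root_sum G \<psi>"
proof (rule tendsto_if_subseq_tendsto)
  fix r :: "nat \<Rightarrow> nat" assume r: "strict_mono r"
  have "\<forall>k. \<exists>c v. c \<noteq> 0 \<and> (\<forall>i. norm (v i) = 1) \<and> F k = cmul c (\<Prod>i<d. linear_form (v i))"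
    using form_factorization[OF F] by metis
  then obtain c v where c: "\<And>k. c k \<noteq> 0" and v: "\<And>k i. norm (v k i) = 1"
    and F_eq: "\<And>k. F k = cmul (c k) (\<Prod>i<d. linear_form (v k i))" by metis
  obtain s w where s: "strict_mono s"
    and w': "\<forall>i<d. (\<lambda>k. v (r (s k)) i) \<longlonglongrightarrow> w i \<and> norm (w i) = 1"
    using unit_vectors_subseq[where u = "\<lambda>k. v (r k)" and n = d, OF v] by (elim exE conjE)
  have w: "(\<lambda>k. v (r (s k)) i) \<longlonglongrightarrow> w i" "norm (w i) = 1" if "i < d" for i
    using w' that by simp_all
  have v0: "v k i \<noteq> 0" for k i using v[of k i] by auto
  have w0: "w i \<noteq> 0" if "i < d" for i using w(2)[OF that] by auto
  define W where "W = (\<Prod>i<d. linear_form (w i))"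
  have "W \<noteq> 0" unfolding W_def using w0 linear_form_nonzero by auto
  have W: "homogeneous d W" unfolding W_def using homogeneous_prod_linear_form[of "{..<d}" w] by simp
  \<comment> \<open>a nonzero form cannot vanish on the whole chart $w = 1$\<close>
  obtain z where z: "eval_form W (vector [z, 1]) \<noteq> 0"
    using form_eqI[OF W homogeneous_0] \<open>W \<noteq> 0\<close> by auto
  have rs: "strict_mono (r \<circ> s)" using r s by (rule strict_mono_o)
  have limF: "(\<lambda>k. eval_form (F (r (s k))) x) \<longlonglongrightarrow> eval_form G x" for x
    using LIMSEQ_subseq_LIMSEQ[OF lim[of x] rs] by (simp add: o_def)
  have limW: "(\<lambda>k. eval_form (\<Prod>i<d. linear_form (v (r (s k)) i)) x) \<longlonglongrightarrow> eval_form W x" for x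
    unfolding W_def eval_form_prod eval_form_linear_form
    by (intro tendsto_prod tendsto_diff tendsto_mult tendsto_const tendsto_vec_nth w(1)) simp_all
  define C where "C = eval_form G (vector [z, 1]) / eval_form W (vector [z, 1])"
  have C: "(\<lambda>k. c (r (s k))) \<longlonglongrightarrow> C"
    unfolding C_def
  proof (rule Lim_transform_eventually)
    show "(\<lambda>k. eval_form (F (r (s k))) (vector [z, 1]) /
        eval_form (\<Prod>i<d. linear_form (v (r (s k)) i)) (vector [z, 1]))
      \<longlonglongrightarrow> eval_form G (vector [z, 1]) / eval_form W (vector [z, 1])"
      by (intro tendsto_divide limF limW z)
    have "eventually (\<lambda>k. eval_form (\<Prod>i<d. linear_form (v (r (s k)) i)) (vector [z, 1]) \<noteq> 0) sequentially"
      using tendsto_imp_eventually_ne[OF limW z] .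
    then show "eventually (\<lambda>k. eval_form (F (r (s k))) (vector [z, 1]) /
        eval_form (\<Prod>i<d. linear_form (v (r (s k)) i)) (vector [z, 1]) = c (r (s k))) sequentially"
      by eventually_elim (simp add: F_eq)
  qed
  have "G = cmul C W"
  proof (rule form_eqI[OF G(1) homogeneous_cmul[OF W]])
    fix x
    have "(\<lambda>k. eval_form (F (r (s k))) (vector [x, 1])) \<longlonglongrightarrow> eval_form (cmul C W) (vector [x, 1])"
      unfolding F_eq eval_form_cmul by (intro tendsto_mult C limW)
    with limF show "eval_form G (vector [x, 1]) = eval_form (cmul C W) (vector [x, 1])"
      by (rule LIMSEQ_unique)
  qed
  with G have "C \<noteq> 0" by auto
  have "(\<lambda>k. \<Sum>i<d. \<psi> (abs_cp1 (v (r (s k)) i))) \<longlonglongrightarrow> (\<Sum>i<d. \<psi> (abs_cp1 (w i)))"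
    by (intro tendsto_sum tendsto_cp1 \<psi> w(1) w0 v0) simp_all
  moreover have "root_sum (F (r (s k))) \<psi> = (\<Sum>i<d. \<psi> (abs_cp1 (v (r (s k)) i)))" for k
    by (rule root_sum_factored(2)[OF c _ F_eq]) (rule v0)
  moreover have "root_sum G \<psi> = (\<Sum>i<d. \<psi> (abs_cp1 (w i)))"
    using \<open>G = cmul C W\<close> by (intro root_sum_factored(2)[OF \<open>C \<noteq> 0\<close> w0]) (auto simp: W_def)
  ultimately show "\<exists>s. strict_mono s \<and> (\<lambda>k. root_sum (F (r (s k))) \<psi>) \<longlonglongrightarrow> root_sum G \<psi>"
    using s by auto
qed

section \<open>Pencils of forms and fibres of rational maps\<close>

text \<open>
  For $v = (a, b)$ this is the form $b P - a Q$ whose zeros are the points mapped to $(a : b)$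
  by $(P : Q)$, together with the common zeros of $P$ and $Q$.
\<close>

definition pencil :: "form_pair \<Rightarrow> complex^2 \<Rightarrow> bipoly" where
  "pencil \<Phi> v = cmul (v $ 2) (fst \<Phi>) - cmul (v $ 1) (snd \<Phi>)"

lemma eval_pencil:
  "eval_form (pencil \<Phi> u) v = u $ 2 * eval_form (fst \<Phi>) v - u $ 1 * eval_form (snd \<Phi>) v"
  by (simp add: pencil_def)

lemma homogeneous_pencil: "\<Phi> \<in> form_pairs d \<Longrightarrow> homogeneous d (pencil \<Phi> v)"
  by (auto simp: pencil_def form_pairs_def intro!: homogeneous_diff homogeneous_cmul)

lemma coeff_cmul: "coeff (coeff (cmul c F) i) j = c * coeff (coeff F i) j"
  by simp

lemma pencil_scale: "pencil \<Phi> (c *s v) = cmul c (pencil \<Phi> v)"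
  by (intro poly_eqI)
    (simp only: pencil_def coeff_cmul coeff_diff vector_smult_component right_diff_distrib mult.assoc)

lemma pencil_form_scale: "pencil (form_scale c \<Phi>) v = cmul c (pencil \<Phi> v)"
  by (intro poly_eqI)
    (simp only: pencil_def form_scale_def fst_conv snd_conv coeff_cmul coeff_diff
      right_diff_distrib mult.left_commute)

text \<open>
  The pencil is the $2 \times 2$ determinant with columns $(P, Q)$ and $v$, so applying $A$ to both
  columns multiplies it by $\det A$. Geometrically, $A \circ \Phi$ takes the value $A y$ where $\Phi$
  takes the value $y$.
\<close>

lemma pencil_moebius_comp:
  "pencil (moebius_comp A \<Phi>) (A *v v) = cmul (Determinants.det A) (pencil \<Phi> v)"
proof -
  have vec: "(A *v v) $ 1 = A $ 1 $ 1 * v $ 1 + A $ 1 $ 2 * v $ 2"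
    "(A *v v) $ 2 = A $ 2 $ 1 * v $ 1 + A $ 2 $ 2 * v $ 2"
    by (simp_all add: matrix_vector_mult_def sum_2)
  have alg: "(c * x + e * y) * (a * P + b * Q) - (a * x + b * y) * (c * P + e * Q) =
      (a * e - b * c) * (y * P - x * Q)" for a b c e x y P Q :: complex
    by (simp add: algebra_simps)
  show ?thesis
    unfolding pencil_def moebius_comp_def fst_conv snd_conv vec Determinants.det_2
    by (intro poly_eqI) (simp only: coeff_cmul coeff_diff coeff_add alg)
qed

lemma homogeneous_unit: "homogeneous e F \<Longrightarrow> is_unit F \<Longrightarrow> e = 0"
proof -
  assume F: "homogeneous e F" "is_unit F"
  then obtain a where a: "F = [:a:]" "is_unit a" by (auto simp: is_unit_poly_iff)
  then obtain c where "a = [:c:]" by (auto elim: degree_eq_zeroE)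
  with a have "homogeneous 0 F" using homogeneous_const by simp
  moreover have "F \<noteq> 0" using F(2) by auto
  ultimately show "e = 0" using homogeneous_degree_unique[OF F(1)] by auto
qed

text \<open>
  If $b p = a q$ with $(a, b) \neq 0$, then one of the coprime forms $p, q$ divides the other, so
  one of them is a unit; but a unit has degree $0$.
\<close>

lemma pencil_nonzero:
  assumes \<phi>: "\<phi> \<in> form_pairs e" "coprime (fst \<phi>) (snd \<phi>)" "e > 0" and u: "u \<noteq> 0"
  shows "pencil \<phi> u \<noteq> 0"
proof
  assume "pencil \<phi> u = 0"
  then have eq: "cmul (u $ 2) (fst \<phi>) = cmul (u $ 1) (snd \<phi>)" by (simp add: pencil_def)
  have hom: "homogeneous e (fst \<phi>)" "homogeneous e (snd \<phi>)" using \<phi>(1) by (auto simp: form_pairs_def)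
  show False
  proof (cases "u $ 2 = 0")
    case True
    with u have "u $ 1 \<noteq> 0" by (auto simp: vec2_eq_iff)
    with True eq have "snd \<phi> = 0" by simp
    with \<phi>(2) have "is_unit (fst \<phi>)" by simp
    with hom(1) \<phi>(3) show False using homogeneous_unit by blast
  next
    case False
    have "snd \<phi> dvd [:[:u $ 2:]:] * fst \<phi>"
      unfolding cmul_eq[symmetric] eq by (rule dvd_smult) simp
    then have "snd \<phi> dvd fst \<phi>"
      using is_unit_const[OF False] by (simp only: dvd_mult_unit_iff')
    with \<phi>(2) have "is_unit (snd \<phi>)" by (metis coprime_common_divisor dvd_refl)
    with hom(2) \<phi>(3) show False using homogeneous_unit by blast
  qed
qed

lemma point_form_dvd_if_zero:
  assumes "homogeneous e F" "eval_form F (rep_cp1 x) = 0"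
  shows "point_form x dvd F"
proof (cases "F = 0")
  case False
  with assms have "ord_at x F \<noteq> 0" using ord_at_nonzero_iff by blast
  then show ?thesis
    unfolding ord_at_def using not_dvd_imp_multiplicity_0[of "point_form x" F] by metis
qed simp

lemma coprime_no_common_zero:
  assumes "\<phi> \<in> form_pairs e" "coprime (fst \<phi>) (snd \<phi>)"
  shows "vector [eval_form (fst \<phi>) (rep_cp1 x), eval_form (snd \<phi>) (rep_cp1 x)] \<noteq> (0 :: complex^2)"
proof
  assume "vector [eval_form (fst \<phi>) (rep_cp1 x), eval_form (snd \<phi>) (rep_cp1 x)] = (0 :: complex^2)"
  then have "eval_form (fst \<phi>) (rep_cp1 x) = 0" "eval_form (snd \<phi>) (rep_cp1 x) = 0"
    by (simp_all add: vec2_eq_iff)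
  then have "point_form x dvd fst \<phi>" "point_form x dvd snd \<phi>"
    using assms(1) by (auto simp: form_pairs_def intro: point_form_dvd_if_zero)
  with assms(2) have "is_unit (point_form x)" by (metis coprime_common_divisor)
  moreover have "prime_elem (point_form x)"
    unfolding point_form_eq_linear_form by (intro prime_elem_linear_form rep_cp1_nonzero)
  ultimately show False by (auto dest: prime_elem_not_unit)
qed

text \<open>
  Coprime forms have no common zero, so the zeros of $b p - a q$ are exactly the preimages of
  $(a : b)$, and the order of vanishing is the local degree by definition.
\<close>

lemma push_fun_eq_root_sum:
  assumes \<phi>: "\<phi> \<in> form_pairs e" "coprime (fst \<phi>) (snd \<phi>)" "e > 0"
  shows "push_fun \<phi> \<psi> y = root_sum (pencil \<phi> (rep_cp1 y)) \<psi>"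
proof -
  have iff: "rat_map \<phi> x = y \<longleftrightarrow> ord_at x (pencil \<phi> (rep_cp1 y)) \<noteq> 0" for x
  proof -
    have "rat_map \<phi> x = y \<longleftrightarrow> rat_map \<phi> x = abs_cp1 (rep_cp1 y)" by simp
    also have "\<dots> \<longleftrightarrow> eval_form (pencil \<phi> (rep_cp1 y)) (rep_cp1 x) = 0"
      unfolding rat_map_def
      by (subst abs_cp1_eq_iff[OF coprime_no_common_zero[OF \<phi>(1,2)] rep_cp1_nonzero])
        (auto simp: eval_pencil mult.commute)
    also have "\<dots> \<longleftrightarrow> ord_at x (pencil \<phi> (rep_cp1 y)) \<noteq> 0"
      by (rule ord_at_nonzero_iff[OF homogeneous_pencil[OF \<phi>(1)] pencil_nonzero[OF \<phi> rep_cp1_nonzero],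
            symmetric])
    finally show ?thesis .
  qed
  have "local_degree \<phi> x = ord_at x (pencil \<phi> (rep_cp1 y))" if "rat_map \<phi> x = y" for x
    using that by (simp add: local_degree_def pencil_def Let_def)
  then show ?thesis
    unfolding push_fun_def root_sum_def iff[symmetric] by (intro sum.cong) simp_all
qed

lemma reduction_factorization:
  assumes \<Phi>: "\<Phi> \<in> form_pairs d"
  obtains h e where "h + e = d" "homogeneous h (common_factor \<Phi>)" "common_factor \<Phi> \<noteq> 0"
    "reduction \<Phi> \<in> form_pairs e" "coprime (fst (reduction \<Phi>)) (snd (reduction \<Phi>))"
    "fst \<Phi> = common_factor \<Phi> * fst (reduction \<Phi>)" "snd \<Phi> = common_factor \<Phi> * snd (reduction \<Phi>)"
proof -
  define H p q where "H = common_factor \<Phi>" and "p = fst (reduction \<Phi>)" and "q = snd (reduction \<Phi>)"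
  have P: "homogeneous d (fst \<Phi>)" "homogeneous d (snd \<Phi>)" and nz: "fst \<Phi> \<noteq> 0 \<or> snd \<Phi> \<noteq> 0"
    using \<Phi> by (auto simp: form_pairs_def)
  have eq: "fst \<Phi> = H * p" "snd \<Phi> = H * q"
    by (simp_all add: H_def p_def q_def reduction_def common_factor_def)
  have H0: "H \<noteq> 0" using nz by (auto simp: H_def common_factor_def)
  have "coprime p q"
    using nz unfolding p_def q_def reduction_def common_factor_def fst_conv snd_conv
    by (intro div_gcd_coprime) auto
  obtain h where h: "homogeneous h H"
    using nz divisor_of_form[OF P(1), of H] divisor_of_form[OF P(2), of H] eq by (metis dvd_triv_left)
  have "h \<le> d"
    using nz P divisor_of_form_degree[OF _ _ h, of d p] divisor_of_form_degree[OF _ _ h, of d q] eq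
    by auto
  have "homogeneous (d - h) p" 
    using P(1) divisor_of_form_degree[OF _ _ h, of d p] eq H0 by (cases "p = 0") auto
  moreover have "homogeneous (d - h) q" 
    using P(2) divisor_of_form_degree[OF _ _ h, of d q] eq H0 by (cases "q = 0") auto
  moreover have "(p, q) \<noteq> (0, 0)" using nz eq by auto
  ultimately have "reduction \<Phi> \<in> form_pairs (d - h)"
    by (auto simp: form_pairs_def p_def q_def split: prod.splits)
  with \<open>coprime p q\<close> h H0 eq \<open>h \<le> d\<close> show ?thesis
    by (intro that[of h "d - h"]) (auto simp: H_def p_def q_def)
qed

lemma rat_degree_eq:
  assumes "\<phi> \<in> form_pairs e"
  shows "rat_degree \<phi> = e"
  unfolding rat_degree_def
proof (rule the_equality[of _ e])
  fix e' assume "\<phi> \<in> form_pairs e'"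
  with assms show "e' = e"
    using homogeneous_degree_unique by (cases \<phi>) (auto simp: form_pairs_def)
qed (rule assms)

lemma pencil_reduction:
  assumes "fst \<Phi> = H * fst \<phi>" "snd \<Phi> = H * snd \<phi>"
  shows "pencil \<Phi> v = H * pencil \<phi> v"
  unfolding pencil_def by (simp add: assms right_diff_distrib)

lemma root_sum_pencil_abs:
  assumes "v \<noteq> 0"
  shows "root_sum (pencil \<Phi> (rep_cp1 (abs_cp1 v))) \<psi> = root_sum (pencil \<Phi> v) \<psi>"
proof -
  obtain c where c: "c \<noteq> 0" "rep_cp1 (abs_cp1 v) = c *s v" using rep_abs_cp1[OF assms] .
  show ?thesis unfolding c(2) pencil_scale by (rule root_sum_cmul[OF c(1)])
qed

lemma root_sum_pencil_tendsto:
  fixes \<psi> :: "cp1 \<Rightarrow> real"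
  assumes G: "\<And>k. G k \<in> form_pairs d" "\<And>k. pencil (G k) (v k) \<noteq> 0"
    and \<Phi>: "\<Phi> \<in> form_pairs d" "pencil \<Phi> w \<noteq> 0"
    and lim: "\<And>x. (\<lambda>k. eval_form (fst (G k)) x) \<longlonglongrightarrow> eval_form (fst \<Phi>) x"
      "\<And>x. (\<lambda>k. eval_form (snd (G k)) x) \<longlonglongrightarrow> eval_form (snd \<Phi>) x"
    and v: "v \<longlonglongrightarrow> w"
    and \<psi>: "continuous_on UNIV \<psi>"
  shows "(\<lambda>k. root_sum (pencil (G k) (v k)) \<psi>) \<longlonglongrightarrow> root_sum (pencil \<Phi> w) \<psi>"
proof (rule root_sum_tendsto[OF _ G(2) _ \<Phi>(2) _ \<psi>])
  show "(\<lambda>k. eval_form (pencil (G k) (v k)) x) \<longlonglongrightarrow> eval_form (pencil \<Phi> w) x" for x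
    unfolding eval_pencil by (intro tendsto_intros lim v)
qed (rule homogeneous_pencil[OF G(1)] homogeneous_pencil[OF \<Phi>(1)])+

lemma continuous_on_root_sum_pencil:
  fixes \<psi> :: "cp1 \<Rightarrow> real"
  assumes \<Phi>: "\<Phi> \<in> form_pairs d" "\<And>v. v \<noteq> 0 \<Longrightarrow> pencil \<Phi> v \<noteq> 0" and \<psi>: "continuous_on UNIV \<psi>"
  shows "continuous_on UNIV (\<lambda>y. root_sum (pencil \<Phi> (rep_cp1 y)) \<psi>)"
  unfolding continuous_on_cp1_iff
proof (rule continuous_on_eq)
  show "continuous_on (- {0}) (\<lambda>v. root_sum (pencil \<Phi> v) \<psi>)"
    unfolding continuous_on_sequentially o_def
  proof (intro allI ballI impI)
    fix v w assume w: "w \<in> - {0 :: complex^2}" and v: "(\<forall>k. v k \<in> - {0}) \<and> v \<longlonglongrightarrow> w"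
    show "(\<lambda>k. root_sum (pencil \<Phi> (v k)) \<psi>) \<longlonglongrightarrow> root_sum (pencil \<Phi> w) \<psi>"
      by (rule root_sum_pencil_tendsto[OF \<Phi>(1) _ \<Phi>(1) _ tendsto_const tendsto_const _ \<psi>])
        (use v w \<Phi>(2) in auto)
  qed
qed (simp add: root_sum_pencil_abs)

text \<open>
  It suffices that the differences tend to zero along every sequence of points $y_k$: choose $y_k$
  to be a point where the difference is at least \<open>\<epsilon>\<close> whenever there is one. Along subsequences the
  unit representatives of $y_k$ converge, and both terms tend to the value of the limit pencil at
  the limit vector.
\<close>

lemma root_sum_pencil_uniform:
  fixes \<psi> :: "cp1 \<Rightarrow> real"
  assumes G: "\<And>k. G k \<in> form_pairs d" "\<And>k v. v \<noteq> 0 \<Longrightarrow> pencil (G k) v \<noteq> 0"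
    and \<Phi>: "\<Phi> \<in> form_pairs d" "\<And>v. v \<noteq> 0 \<Longrightarrow> pencil \<Phi> v \<noteq> 0"
    and lim: "\<And>x. (\<lambda>k. eval_form (fst (G k)) x) \<longlonglongrightarrow> eval_form (fst \<Phi>) x"
      "\<And>x. (\<lambda>k. eval_form (snd (G k)) x) \<longlonglongrightarrow> eval_form (snd \<Phi>) x"
    and \<psi>: "continuous_on UNIV \<psi>" and "\<epsilon> > 0"
  shows "\<forall>\<^sub>F k in sequentially. \<forall>y.
    \<bar>root_sum (pencil (G k) (rep_cp1 y)) \<psi> - root_sum (pencil \<Phi> (rep_cp1 y)) \<psi>\<bar> < \<epsilon>"
proof -
  define D where "D k y =
    root_sum (pencil (G k) (rep_cp1 y)) \<psi> - root_sum (pencil \<Phi> (rep_cp1 y)) \<psi>" for k y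
  have D0: "(\<lambda>k. D k (y k)) \<longlonglongrightarrow> 0" for y
  proof (rule tendsto_if_subseq_tendsto)
    fix r :: "nat \<Rightarrow> nat" assume r: "strict_mono r"
    obtain s u where s: "strict_mono s"
      and u: "\<forall>i<(1::nat). (\<lambda>k. unit_rep (y (r (s k)))) \<longlonglongrightarrow> u i \<and> norm (u i) = 1"
      using unit_vectors_subseq[where u = "\<lambda>k i. unit_rep (y (r k))" and n = 1, OF norm_unit_rep] by (elim exE conjE)
    define w where "w = u (0::nat)"
    have w: "(\<lambda>k. unit_rep (y (r (s k)))) \<longlonglongrightarrow> w" "norm w = 1"
      using u by (simp_all add: w_def)
    have w0: "w \<noteq> 0" using w(2) by auto
    have rs: "strict_mono (r \<circ> s)" using r s by (rule strict_mono_o)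
    have "(\<lambda>k. root_sum (pencil (G (r (s k))) (unit_rep (y (r (s k))))) \<psi> -
        root_sum (pencil \<Phi> (unit_rep (y (r (s k))))) \<psi>)
      \<longlonglongrightarrow> root_sum (pencil \<Phi> w) \<psi> - root_sum (pencil \<Phi> w) \<psi>"
    proof (rule tendsto_diff)
      show "(\<lambda>k. root_sum (pencil (G (r (s k))) (unit_rep (y (r (s k))))) \<psi>)
          \<longlonglongrightarrow> root_sum (pencil \<Phi> w) \<psi>"
        using LIMSEQ_subseq_LIMSEQ[OF lim(1) rs] LIMSEQ_subseq_LIMSEQ[OF lim(2) rs]
        by (intro root_sum_pencil_tendsto[OF G(1) G(2) \<Phi>(1) \<Phi>(2) _ _ w(1) \<psi>])
          (simp_all add: o_def w0)
      show "(\<lambda>k. root_sum (pencil \<Phi> (unit_rep (y (r (s k))))) \<psi>) \<longlonglongrightarrow> root_sum (pencil \<Phi> w) \<psi>"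
        by (intro root_sum_pencil_tendsto[OF \<Phi>(1) \<Phi>(2) \<Phi>(1) \<Phi>(2) tendsto_const tendsto_const w(1) \<psi>])
          (simp_all add: w0)
    qed
    moreover have "root_sum (pencil \<Psi> (unit_rep x)) \<psi> = root_sum (pencil \<Psi> (rep_cp1 x)) \<psi>" for \<Psi> x
      using root_sum_pencil_abs[of "unit_rep x"] by simp
    ultimately have "(\<lambda>k. D (r (s k)) (y (r (s k)))) \<longlonglongrightarrow> 0" by (simp add: D_def)
    with s show "\<exists>s. strict_mono s \<and> (\<lambda>k. D (r (s k)) (y (r (s k)))) \<longlonglongrightarrow> 0" by blast
  qed
  \<comment> \<open>a witness of failure at index $k$ if there is one, and an arbitrary point otherwise\<close>
  define y where "y k = (SOME x. \<bar>D k x\<bar> \<ge> \<epsilon>)" for k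
  have "eventually (\<lambda>k. \<bar>D k (y k)\<bar> < \<epsilon>) sequentially"
    using D0[of y] \<open>\<epsilon> > 0\<close> by (auto simp: tendsto_iff)
  then have "eventually (\<lambda>k. \<forall>x. \<bar>D k x\<bar> < \<epsilon>) sequentially"
  proof eventually_elim
    case (elim k)
    show ?case
    proof (rule ccontr)
      assume "\<not> ?thesis"
      then have "\<exists>x. \<bar>D k x\<bar> \<ge> \<epsilon>" by (auto simp: not_less)
      then have "\<bar>D k (y k)\<bar> \<ge> \<epsilon>" unfolding y_def by (rule someI_ex)
      with elim show False by simp
    qed
  qed
  then show ?thesis by (simp add: D_def)
qed

section \<open>Borel measures and their pullbacks\<close>

lemma integrable_continuous_cp1:
  fixes \<psi> :: "cp1 \<Rightarrow> real"
  assumes "finite_measure M" "sets M = sets borel" "continuous_on UNIV \<psi>"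
  shows "integrable M \<psi>"
proof -
  obtain B where B: "\<And>x. \<bar>\<psi> x\<bar> \<le> B" using continuous_cp1_bounded[OF assms(3)] by blast
  have "\<psi> \<in> borel_measurable M"
    using borel_measurable_continuous_onI[OF assms(3)] assms(2) by (simp cong: measurable_cong_sets)
  then show ?thesis using B
    by (intro finite_measure.integrable_const_bound[OF assms(1), of _ B]) auto
qed

lemma measure_open_limit:
  fixes \<psi> :: "nat \<Rightarrow> cp1 \<Rightarrow> real"
  assumes M: "finite_measure M" "sets M = sets borel" and "open A"
    and \<psi>: "\<And>n. continuous_on UNIV (\<psi> n)" "\<And>n x. 0 \<le> \<psi> n x" "\<And>n x. \<psi> n x \<le> 1"
      "\<And>x. (\<lambda>n. \<psi> n x) \<longlonglongrightarrow> indicator A x"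
  shows "(\<lambda>n. \<integral>x. \<psi> n x \<partial>M) \<longlonglongrightarrow> measure M A"
proof -
  interpret finite_measure M by (rule M)
  have A: "A \<in> sets M" using \<open>open A\<close> M(2) by simp
  have "(\<lambda>n. \<integral>x. \<psi> n x \<partial>M) \<longlonglongrightarrow> (\<integral>x. indicator A x \<partial>M)"
  proof (rule integral_dominated_convergence[where w = "\<lambda>_. 1"])
    show "\<psi> n \<in> borel_measurable M" for n
      using borel_measurable_continuous_onI[OF \<psi>(1)] M(2) by (simp cong: measurable_cong_sets)
  qed (use A \<psi> in auto)
  then show ?thesis using A by simp
qed

lemma borel_measure_eqI_open:
  fixes M N :: "'a::topological_space measure"
  assumes "finite_measure M" "sets M = sets borel" "sets N = sets borel"
    and eq: "\<And>A. open A \<Longrightarrow> emeasure M A = emeasure N A"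
  shows "M = N"
proof (rule measure_eqI_generator_eq[where \<Omega> = UNIV and E = "{S. open S}" and A = "\<lambda>_. UNIV"])
  show "Int_stable {S. open (S :: 'a set)}" by (auto simp: Int_stable_def)
  show "sets M = sigma_sets UNIV {S. open S}" "sets N = sigma_sets UNIV {S. open S}"
    using assms(2,3) by (simp_all add: borel_def)
  show "emeasure M UNIV \<noteq> \<infinity>" using finite_measure.emeasure_finite[OF assms(1)] by auto
qed (use eq in auto)

text \<open>
  Indicators of open sets are limits of continuous functions with values in $[0, 1]$, and open sets
  form a generator of the Borel sets that is stable under intersection.
\<close>

lemma borel_cp1_measure_eqI:
  fixes M N :: "cp1 measure"
  assumes M: "finite_measure M" "sets M = sets borel" and N: "finite_measure N" "sets N = sets borel"
    and eq: "\<And>\<psi> :: cp1 \<Rightarrow> real. continuous_on UNIV \<psi> \<Longrightarrow> (\<integral>x. \<psi> x \<partial>M) = (\<integral>x. \<psi> x \<partial>N)"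
  shows "M = N"
proof (rule borel_measure_eqI_open[OF M N(2)])
  fix A :: "cp1 set" assume "open A"
  obtain \<psi> :: "nat \<Rightarrow> cp1 \<Rightarrow> real" where
    \<psi>: "\<And>n. continuous_on UNIV (\<psi> n)" "\<And>n x. 0 \<le> \<psi> n x" "\<And>n x. \<psi> n x \<le> 1"
      "\<And>x. (\<lambda>n. \<psi> n x) \<longlonglongrightarrow> indicator A x"
    using open_cp1_indicator_limit[OF \<open>open A\<close>] by blast
  have "measure M A = measure N A"
    using measure_open_limit[OF M \<open>open A\<close> \<psi>] measure_open_limit[OF N \<open>open A\<close> \<psi>]
    unfolding eq[OF \<psi>(1)] by (rule LIMSEQ_unique)
  then show "emeasure M A = emeasure N A"
    by (simp add: finite_measure.emeasure_eq_measure M N)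
qed

lemma integral_scale_measure:
  fixes f :: "'a \<Rightarrow> real"
  assumes "f \<in> borel_measurable M" "r \<ge> 0"
  shows "(\<integral>x. f x \<partial>(scale_measure (ennreal r) M)) = r * (\<integral>x. f x \<partial>M)"
proof -
  have "scale_measure (ennreal r) M = density M (\<lambda>_. ennreal r)"
    by (rule measure_eqI) (auto simp: emeasure_density nn_integral_cmult)
  then show ?thesis using assms by (simp add: integral_density)
qed

lemma root_sum_add_const:
  assumes "homogeneous d F" "F \<noteq> 0"
  shows "root_sum F (\<lambda>x. \<psi> x + B) = root_sum F \<psi> + real d * B"
    and root_sum_nonneg: "(\<And>x. 0 \<le> \<psi> x) \<Longrightarrow> 0 \<le> root_sum F \<psi>"
proof -
  obtain c v where cv: "c \<noteq> 0" "\<And>i. norm (v i) = 1" "F = cmul c (\<Prod>i<d. linear_form (v i))"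
    using form_factorization[OF assms] by metis
  have v0: "v i \<noteq> 0" for i using cv(2)[of i] by auto
  have "root_sum F \<psi> = (\<Sum>i<d. \<psi> (abs_cp1 (v i)))" for \<psi>
    by (rule root_sum_factored(2)[OF cv(1) _ cv(3)]) (rule v0)
  then show "root_sum F (\<lambda>x. \<psi> x + B) = root_sum F \<psi> + real d * B"
    "(\<And>x. 0 \<le> \<psi> x) \<Longrightarrow> 0 \<le> root_sum F \<psi>"
    by (simp_all add: sum.distrib sum_nonneg)
qed

text \<open>
  The kernel sends $y$ to the uniform distribution on the $e$ zeros, with multiplicity, of the pencil
  member at $y$. Only the sums over all zeros depend continuously on $y$, not a choice of the
  individual zeros; so measurability is checked on an open set $A$, where the mass is a limit of
  sums of continuous functions over the zeros.
\<close>

lemma measurable_root_kernel: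
  assumes \<phi>: "\<phi> \<in> form_pairs e" "\<And>v. v \<noteq> 0 \<Longrightarrow> pencil \<phi> v \<noteq> 0" and "e > 0"
  obtains K :: "cp1 \<Rightarrow> cp1 measure" where "K \<in> borel \<rightarrow>\<^sub>M prob_algebra borel"
    "\<And>y \<psi>. \<psi> \<in> borel_measurable borel \<Longrightarrow> (\<And>x. 0 \<le> \<psi> x) \<Longrightarrow>
      (\<integral>\<^sup>+x. ennreal (\<psi> x) \<partial>K y) = ennreal (root_sum (pencil \<phi> (rep_cp1 y)) \<psi> / real e)"
proof -
  have "\<forall>y. \<exists>v. \<forall>\<psi>. root_sum (pencil \<phi> (rep_cp1 y)) \<psi> = (\<Sum>i<e. \<psi> (v i))"
  proof
    fix y
    obtain c v where cv: "c \<noteq> 0" "\<And>i. norm (v i) = 1"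
        "pencil \<phi> (rep_cp1 y) = cmul c (\<Prod>i<e. linear_form (v i))"
      using form_factorization[OF homogeneous_pencil[OF \<phi>(1)] \<phi>(2)[OF rep_cp1_nonzero[of y]]] by metis
    have v0: "v i \<noteq> 0" for i using cv(2)[of i] by auto
    have "root_sum (pencil \<phi> (rep_cp1 y)) \<psi> = (\<Sum>i<e. \<psi> (abs_cp1 (v i)))" for \<psi>
      by (rule root_sum_factored(2)[OF cv(1) _ cv(3)]) (rule v0)
    then show "\<exists>v. \<forall>\<psi>. root_sum (pencil \<phi> (rep_cp1 y)) \<psi> = (\<Sum>i<e. \<psi> (v i))"
      by (intro exI[of _ "\<lambda>i. abs_cp1 (v i)"]) simp
  qed
  then obtain v where v: "\<And>y \<psi>. root_sum (pencil \<phi> (rep_cp1 y)) \<psi> = (\<Sum>i<e. \<psi> (v y i))" by metis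
  define K :: "cp1 \<Rightarrow> cp1 measure" where "K y = distr (measure_pmf (pmf_of_set {..<e})) borel (v y)" for y
  have ne: "{..<e} \<noteq> {}" using \<open>e > 0\<close> by auto
  have K_prob: "prob_space (K y)" and K_sets: "sets (K y) = sets borel" for y
    unfolding K_def by (auto intro!: prob_space.prob_space_distr measure_pmf.prob_space_axioms)
  have K_int: "(\<integral>x. \<psi> x \<partial>K y) = root_sum (pencil \<phi> (rep_cp1 y)) \<psi> / real e"
    if "\<psi> \<in> borel_measurable borel" for y and \<psi> :: "cp1 \<Rightarrow> real"
    using that ne by (simp add: K_def v integral_distr integral_pmf_of_set)
  have "K \<in> borel \<rightarrow>\<^sub>M prob_algebra borel"
  proof (rule measurable_prob_algebra_generated[where \<Omega> = UNIV and G = "{S. open S}"])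
    show "sets borel = sigma_sets UNIV {S. open (S :: cp1 set)}" by (simp add: borel_def)
    show "Int_stable {S. open (S :: cp1 set)}" by (auto simp: Int_stable_def)
    fix A :: "cp1 set" assume "A \<in> {S. open S}"
    then have "open A" by simp
    obtain \<psi> :: "nat \<Rightarrow> cp1 \<Rightarrow> real" where
      \<psi>: "\<And>n. continuous_on UNIV (\<psi> n)" "\<And>n x. 0 \<le> \<psi> n x" "\<And>n x. \<psi> n x \<le> 1"
        "\<And>x. (\<lambda>n. \<psi> n x) \<longlonglongrightarrow> indicator A x"
      using open_cp1_indicator_limit[OF \<open>open A\<close>] by blast
    have fin: "finite_measure (K y)" for y using K_prob by (rule prob_space.finite_measure)
    have "(\<lambda>y. measure (K y) A) \<in> borel_measurable borel"
    proof (rule borel_measurable_LIMSEQ_real)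
      show "(\<lambda>n. root_sum (pencil \<phi> (rep_cp1 y)) (\<psi> n) / real e) \<longlonglongrightarrow> measure (K y) A" for y
        using measure_open_limit[OF fin K_sets \<open>open A\<close> \<psi>]
        by (simp add: K_int borel_measurable_continuous_onI \<psi>)
      show "(\<lambda>y. root_sum (pencil \<phi> (rep_cp1 y)) (\<psi> n) / real e) \<in> borel_measurable borel" for n
        using borel_measurable_continuous_onI[OF continuous_on_root_sum_pencil[OF \<phi> \<psi>(1)]] by simp
    qed
    then show "(\<lambda>y. emeasure (K y) A) \<in> borel_measurable borel"
      by (simp add: finite_measure.emeasure_eq_measure[OF fin])
  qed (use K_prob K_sets in auto)
  moreover have "(\<integral>\<^sup>+x. ennreal (\<psi> x) \<partial>K y) = ennreal (root_sum (pencil \<phi> (rep_cp1 y)) \<psi> / real e)"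
    if "\<psi> \<in> borel_measurable borel" "\<And>x. 0 \<le> \<psi> x" for y \<psi>
    using that ne
    by (simp add: K_def v nn_integral_distr nn_integral_pmf_of_set ennreal_of_nat_eq_real_of_nat
        sum_nonneg divide_ennreal sum_ennreal \<open>e > 0\<close>)
  ultimately show ?thesis by (rule that)
qed

text \<open>
  The measure is $e$ times the mixture of the root kernel over \<open>\<mu>\<close>. The integral formula comes from
  the one for nonnegative functions by adding a constant, which changes a sum over the $e$ zeros by
  $e$ times that constant.
\<close>

lemma pullback_measure_exists:
  assumes \<phi>: "\<phi> \<in> form_pairs e" "\<And>v. v \<noteq> 0 \<Longrightarrow> pencil \<phi> v \<noteq> 0" and "e > 0" and "borel_prob \<mu>"
  obtains \<nu> :: "cp1 measure" where "finite_measure \<nu>" "sets \<nu> = sets borel"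
    "\<And>\<psi>. continuous_on UNIV \<psi> \<Longrightarrow>
      (\<integral>x. \<psi> x \<partial>\<nu>) = (\<integral>y. root_sum (pencil \<phi> (rep_cp1 y)) \<psi> \<partial>\<mu>)"
proof -
  obtain K :: "cp1 \<Rightarrow> cp1 measure" where K: "K \<in> borel \<rightarrow>\<^sub>M prob_algebra borel" and
    K_int: "\<And>y \<psi>. \<psi> \<in> borel_measurable borel \<Longrightarrow> (\<And>x. 0 \<le> \<psi> x) \<Longrightarrow>
      (\<integral>\<^sup>+x. ennreal (\<psi> x) \<partial>K y) = ennreal (root_sum (pencil \<phi> (rep_cp1 y)) \<psi> / real e)"
    using measurable_root_kernel[OF \<phi> \<open>e > 0\<close>] by blast
  interpret \<mu>: prob_space \<mu> using \<open>borel_prob \<mu>\<close> by (simp add: borel_prob_def)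
  have sets_\<mu>: "sets \<mu> = sets borel" using \<open>borel_prob \<mu>\<close> by (simp add: borel_prob_def)
  have K\<mu>: "K \<in> \<mu> \<rightarrow>\<^sub>M prob_algebra borel" using K sets_\<mu> by (simp cong: measurable_cong_sets)
  have K': "K \<in> \<mu> \<rightarrow>\<^sub>M subprob_algebra borel" using K\<mu> by (rule measurable_prob_algebraD)
  define N where "N = \<mu> \<bind> K"
  have \<mu>_alg: "\<mu> \<in> space (prob_algebra borel)"
    using sets_\<mu> \<mu>.prob_space_axioms by (simp add: space_prob_algebra)
  have sets_N: "sets N = sets borel" unfolding N_def by (rule sets_bind'[OF \<mu>_alg K])
  have prob_N: "prob_space N" unfolding N_def by (rule prob_space_bind'[OF \<mu>_alg K])
  interpret N: prob_space N by (rule prob_N)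
  have cont: "continuous_on UNIV (\<lambda>y. root_sum (pencil \<phi> (rep_cp1 y)) \<psi>)"
    if "continuous_on UNIV \<psi>" for \<psi> :: "cp1 \<Rightarrow> real"
    by (rule continuous_on_root_sum_pencil[OF \<phi> that])
  have pos: "real e * (\<integral>x. \<psi> x \<partial>N) = (\<integral>y. root_sum (pencil \<phi> (rep_cp1 y)) \<psi> \<partial>\<mu>)"
    if \<psi>: "continuous_on UNIV \<psi>" "\<And>x. 0 \<le> \<psi> x" for \<psi> :: "cp1 \<Rightarrow> real"
  proof -
    have b: "\<psi> \<in> borel_measurable borel" using \<psi>(1) by (rule borel_measurable_continuous_onI)
    have b2: "(\<lambda>y. root_sum (pencil \<phi> (rep_cp1 y)) \<psi>) \<in> borel_measurable \<mu>"
      using borel_measurable_continuous_onI[OF cont[OF \<psi>(1)]] sets_\<mu> by (simp cong: measurable_cong_sets)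
    have nn: "0 \<le> root_sum (pencil \<phi> (rep_cp1 y)) \<psi>" for y
      using \<psi>(2) by (intro root_sum_nonneg[OF homogeneous_pencil[OF \<phi>(1)] \<phi>(2)]) auto
    have bN: "\<psi> \<in> borel_measurable N" using b sets_N by (simp cong: measurable_cong_sets)
    have "(\<integral>x. \<psi> x \<partial>N) = enn2real (\<integral>\<^sup>+x. ennreal (\<psi> x) \<partial>N)"
      using bN \<psi>(2) by (intro integral_eq_nn_integral) auto
    also have "(\<integral>\<^sup>+x. ennreal (\<psi> x) \<partial>N) = (\<integral>\<^sup>+y. \<integral>\<^sup>+x. ennreal (\<psi> x) \<partial>K y \<partial>\<mu>)"
      unfolding N_def using b by (intro nn_integral_bind[OF _ K']) simp
    also have "\<dots> = (\<integral>\<^sup>+y. ennreal (root_sum (pencil \<phi> (rep_cp1 y)) \<psi> / real e) \<partial>\<mu>)"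
      by (simp add: K_int b \<psi>)
    also have "enn2real \<dots> = (\<integral>y. root_sum (pencil \<phi> (rep_cp1 y)) \<psi> / real e \<partial>\<mu>)"
      using b2 nn by (intro integral_eq_nn_integral[symmetric]) auto
    finally show ?thesis using \<open>e > 0\<close> by simp
  qed
  have eq: "real e * (\<integral>x. \<psi> x \<partial>N) = (\<integral>y. root_sum (pencil \<phi> (rep_cp1 y)) \<psi> \<partial>\<mu>)"
    if \<psi>: "continuous_on UNIV \<psi>" for \<psi> :: "cp1 \<Rightarrow> real"
  proof -
    obtain B where B: "\<And>x. \<bar>\<psi> x\<bar> \<le> B" using continuous_cp1_bounded[OF \<psi>] by blast
    have "0 \<le> \<psi> x + B" for x using B[of x] by linarith
    then have "real e * (\<integral>x. \<psi> x + B \<partial>N) =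
        (\<integral>y. root_sum (pencil \<phi> (rep_cp1 y)) (\<lambda>x. \<psi> x + B) \<partial>\<mu>)"
      using \<psi> by (intro pos) (auto intro!: continuous_intros)
    also have "\<dots> = (\<integral>y. root_sum (pencil \<phi> (rep_cp1 y)) \<psi> + real e * B \<partial>\<mu>)"
      by (simp add: root_sum_add_const[OF homogeneous_pencil[OF \<phi>(1)] \<phi>(2)])
    also have "\<dots> = (\<integral>y. root_sum (pencil \<phi> (rep_cp1 y)) \<psi> \<partial>\<mu>) + real e * B"
      using integrable_continuous_cp1[OF \<mu>.finite_measure sets_\<mu> cont[OF \<psi>]]
      by (simp add: \<mu>.prob_space)
    also have "(\<integral>x. \<psi> x + B \<partial>N) = (\<integral>x. \<psi> x \<partial>N) + B"
      using integrable_continuous_cp1[OF N.finite_measure sets_N \<psi>]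
      by (simp add: N.prob_space)
    finally show ?thesis by (simp add: algebra_simps)
  qed
  define \<nu> where "\<nu> = scale_measure (ennreal (real e)) N"
  show ?thesis
  proof (rule that[of \<nu>])
    show "sets \<nu> = sets borel" by (simp add: \<nu>_def sets_N)
    show "finite_measure \<nu>"
      by (rule finite_measureI)
        (simp add: \<nu>_def space_scale_measure N.emeasure_space_1)
    fix \<psi> :: "cp1 \<Rightarrow> real" assume \<psi>: "continuous_on UNIV \<psi>"
    have "\<psi> \<in> borel_measurable N"
      using borel_measurable_continuous_onI[OF \<psi>] sets_N by (simp cong: measurable_cong_sets)
    then show "(\<integral>x. \<psi> x \<partial>\<nu>) = (\<integral>y. root_sum (pencil \<phi> (rep_cp1 y)) \<psi> \<partial>\<mu>)"
      unfolding \<nu>_def by (subst integral_scale_measure) (simp_all add: eq[OF \<psi>])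
  qed
qed

text \<open>
  Existence and uniqueness together give meaning to the definite description that defines the
  pullback.
\<close>

lemma pullback_measure_characterization:
  assumes \<phi>: "\<phi> \<in> form_pairs e" "coprime (fst \<phi>) (snd \<phi>)" "e > 0" and \<mu>: "borel_prob \<mu>"
  shows "finite_measure (pullback_measure \<phi> \<mu>)"
    and "sets (pullback_measure \<phi> \<mu>) = sets borel"
    and "continuous_on UNIV \<psi> \<Longrightarrow> (\<integral>x. \<psi> x \<partial>(pullback_measure \<phi> \<mu>)) =
      (\<integral>y. root_sum (pencil \<phi> (rep_cp1 y)) \<psi> \<partial>\<mu>)"
proof -
  let ?P = "\<lambda>\<nu>. finite_measure \<nu> \<and> sets \<nu> = sets borel \<and>
    (\<forall>\<psi>. continuous_on UNIV \<psi> \<longrightarrow> (\<integral>x. \<psi> x \<partial>\<nu>) = (\<integral>y. push_fun \<phi> \<psi> y \<partial>\<mu>))"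
  obtain \<nu> :: "cp1 measure" where \<nu>: "finite_measure \<nu>" "sets \<nu> = sets borel"
    "\<And>\<psi>. continuous_on UNIV \<psi> \<Longrightarrow>
      (\<integral>x. \<psi> x \<partial>\<nu>) = (\<integral>y. root_sum (pencil \<phi> (rep_cp1 y)) \<psi> \<partial>\<mu>)"
    using pullback_measure_exists[OF \<phi>(1) pencil_nonzero[OF \<phi>] \<phi>(3) \<mu>] by blast
  have "?P \<nu>" using \<nu> by (simp add: push_fun_eq_root_sum[OF \<phi>])
  moreover have "\<nu>' = \<nu>" if "?P \<nu>'" for \<nu>'
    using that \<open>?P \<nu>\<close> by (intro borel_cp1_measure_eqI) auto
  ultimately have "pullback_measure \<phi> \<mu> = \<nu>"
    unfolding pullback_measure_def by (rule the_equality)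
  with \<nu> show "finite_measure (pullback_measure \<phi> \<mu>)" "sets (pullback_measure \<phi> \<mu>) = sets borel"
    "continuous_on UNIV \<psi> \<Longrightarrow> (\<integral>x. \<psi> x \<partial>(pullback_measure \<phi> \<mu>)) =
      (\<integral>y. root_sum (pencil \<phi> (rep_cp1 y)) \<psi> \<partial>\<mu>)"
    by auto
qed

section \<open>Convergence of pairs of forms up to scaling\<close>

text \<open>
  The Boolean selects the first or the second form of the pair.
\<close>

definition form_coord :: "bool \<Rightarrow> nat \<Rightarrow> nat \<Rightarrow> form_pair \<Rightarrow> complex" where
  "form_coord b i j \<Phi> = coeff (coeff (if b then fst \<Phi> else snd \<Phi>) i) j"

lemma form_coord_scale: "form_coord b i j (form_scale c \<Phi>) = c * form_coord b i j \<Phi>"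
  by (simp add: form_coord_def form_scale_def)

lemma form_scale_form_pairs:
  assumes "\<Phi> \<in> form_pairs d" "c \<noteq> 0"
  shows "form_scale c \<Phi> \<in> form_pairs d"
  using assms by (auto simp: form_pairs_def form_scale_def intro!: homogeneous_cmul)

lemma form_scale_1: "form_scale 1 \<Phi> = \<Phi>"
  by (intro prod_eqI poly_eqI) (simp_all add: form_scale_def)

lemma proj_class_eqD:
  assumes "proj_class \<Phi> = proj_class \<Psi>"
  obtains c where "c \<noteq> 0" "\<Phi> = form_scale c \<Psi>"
proof -
  have "\<Phi> \<in> proj_class \<Phi>"
    unfolding proj_class_def by (auto intro!: exI[of _ 1] simp: form_scale_1)
  then have "\<Phi> \<in> proj_class \<Psi>" using assms by simp
  then show ?thesis using that by (auto simp: proj_class_def)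
qed

text \<open>
  A scaling-invariant open set of pairs is the full preimage of its image.
\<close>

lemma openin_RatBar_image:
  assumes U: "openin (form_pairs_topology d) U"
    and sat: "\<And>c \<Phi>. \<Phi> \<in> U \<Longrightarrow> c \<noteq> 0 \<Longrightarrow> form_scale c \<Phi> \<in> U"
  shows "openin (RatBar_topology d) (proj_class ` U)"
    and "proj_class \<Phi> \<in> proj_class ` U \<Longrightarrow> \<Phi> \<in> U"
proof -
  have sub: "U \<subseteq> form_pairs d" using openin_subset[OF U] by simp
  show mem: "\<Phi> \<in> U" if "proj_class \<Phi> \<in> proj_class ` U" for \<Phi>
  proof -
    from that obtain \<Psi> where \<Psi>: "\<Psi> \<in> U" "proj_class \<Phi> = proj_class \<Psi>" by auto
    obtain c where "c \<noteq> 0" "\<Phi> = form_scale c \<Psi>" using proj_class_eqD[OF \<Psi>(2)] .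
    then show ?thesis using sat[OF \<Psi>(1)] by simp
  qed
  have "{\<Phi> \<in> form_pairs d. proj_class \<Phi> \<in> proj_class ` U} = U"
  proof (intro equalityI subsetI)
    fix \<Phi> assume "\<Phi> \<in> {\<Phi> \<in> form_pairs d. proj_class \<Phi> \<in> proj_class ` U}"
    then show "\<Phi> \<in> U" using mem[of \<Phi>] by simp
  next
    fix \<Phi> assume "\<Phi> \<in> U"
    then show "\<Phi> \<in> {\<Phi> \<in> form_pairs d. proj_class \<Phi> \<in> proj_class ` U}" using sub by blast
  qed
  then show "openin (RatBar_topology d) (proj_class ` U)"
    unfolding openin_RatBar_topology RatBar_def using U image_mono[OF sub] by simp
qed

text \<open>
  The ratio of two coordinates is invariant under scaling and continuous where the denominator does
  not vanish. The inequality is cleared of denominators; being strict, it also forces the reference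
  coordinate of $G_k$ to be nonzero.
\<close>

lemma RatBar_eventually_ratio:
  assumes lim: "limitin (RatBar_topology d) (\<lambda>k. proj_class (G k)) (proj_class \<Phi>) sequentially"
    and G: "\<And>k. G k \<in> form_pairs d" and \<Phi>: "\<Phi> \<in> form_pairs d"
    and nz: "form_coord b0 i0 j0 \<Phi> \<noteq> 0" and "\<epsilon> > 0"
  shows "\<forall>\<^sub>F k in sequentially.
    cmod (form_coord b i j (G k) - form_coord b i j \<Phi> / form_coord b0 i0 j0 \<Phi> * form_coord b0 i0 j0 (G k))
    < \<epsilon> * cmod (form_coord b0 i0 j0 (G k))"
proof -
  define t where "t = form_coord b i j \<Phi> / form_coord b0 i0 j0 \<Phi>"
  define U where "U = {\<Psi> \<in> form_pairs d.
    cmod (form_coord b i j \<Psi> - t * form_coord b0 i0 j0 \<Psi>) < \<epsilon> * cmod (form_coord b0 i0 j0 \<Psi>)}"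
  define p where "p b i j g = (if b then fst (g (i, j)) else snd (g (i, j)))"
    for b and i j :: nat and g :: "nat \<times> nat \<Rightarrow> complex \<times> complex"
  have p_coords: "p b i j (coords \<Psi>) = form_coord b i j \<Psi>" for b i j \<Psi>
    by (simp add: p_def coords_def form_coord_def)
  have p_cont: "continuous_on UNIV (p b i j)" for b i j
    unfolding p_def
    by (cases b) (simp_all add: continuous_on_fst continuous_on_snd continuous_on_product_coordinates)
  \<comment> \<open>the condition defining $U$, read on the coordinates\<close>
  define W where "W = {g. cmod (p b i j g - t * p b0 i0 j0 g) < \<epsilon> * cmod (p b0 i0 j0 g)}"
  have "open W" unfolding W_def
    by (intro open_Collect_less continuous_intros p_cont)
  moreover have "U = coords -` W \<inter> form_pairs d"
    by (auto simp: U_def W_def p_coords)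
  ultimately have U_open: "openin (form_pairs_topology d) U"
    unfolding form_pairs_topology_def openin_pullback_topology by (intro exI[of _ W]) simp
  have sat: "form_scale c \<Psi> \<in> U" if "\<Psi> \<in> U" "c \<noteq> 0" for c \<Psi>
  proof -
    have "cmod (c * form_coord b i j \<Psi> - t * (c * form_coord b0 i0 j0 \<Psi>)) =
        cmod c * cmod (form_coord b i j \<Psi> - t * form_coord b0 i0 j0 \<Psi>)"
      by (simp add: norm_mult[symmetric] algebra_simps)
    also have "\<dots> < cmod c * (\<epsilon> * cmod (form_coord b0 i0 j0 \<Psi>))"
      using that by (intro mult_strict_left_mono) (auto simp: U_def)
    finally show ?thesis
      using that by (simp add: U_def form_coord_scale form_scale_form_pairs norm_mult mult_ac)
  qed
  note U = openin_RatBar_image[OF U_open sat]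
  have "\<Phi> \<in> U" using \<Phi> nz \<open>\<epsilon> > 0\<close> by (simp add: U_def t_def)
  then have "\<forall>\<^sub>F k in sequentially. proj_class (G k) \<in> proj_class ` U"
    using lim U(1) unfolding limitin_def by blast
  then show ?thesis
  proof eventually_elim
    case (elim k)
    have "G k \<in> U" by (rule U(2)[OF _ _ elim])
    then show ?case by (simp add: U_def t_def)
  qed
qed

lemma form_pairs_coord_nonzero:
  assumes "\<Phi> \<in> form_pairs d"
  obtains b i j where "form_coord b i j \<Phi> \<noteq> 0"
proof -
  have "fst \<Phi> \<noteq> 0 \<or> snd \<Phi> \<noteq> 0" using assms by (auto simp: form_pairs_def)
  then obtain b where b: "(if b then fst \<Phi> else snd \<Phi>) \<noteq> 0"
    by (cases "fst \<Phi> = 0") (use that[of True] that[of False] in \<open>simp_all\<close>)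
  define F where "F = (if b then fst \<Phi> else snd \<Phi>)"
  have "coeff (coeff F (degree F)) (degree (coeff F (degree F))) \<noteq> 0" using b by (simp add: F_def)
  then show ?thesis
    by (intro that[of b "degree F" "degree (coeff F (degree F))"]) (simp add: form_coord_def F_def)
qed

text \<open>
  Rescale each pair so that a coordinate in which $\Phi$ does not vanish takes the same value as for
  $\Phi$; the other coordinates then converge because their ratios to this one do.
\<close>

lemma RatBar_limit_representatives:
  assumes lim: "limitin (RatBar_topology d) (\<lambda>k. proj_class (G k)) (proj_class \<Phi>) sequentially"
    and G: "\<And>k. G k \<in> form_pairs d" and \<Phi>: "\<Phi> \<in> form_pairs d"
  obtains c where "\<forall>k. c k \<noteq> 0"
    "\<forall>x. (\<lambda>k. eval_form (fst (form_scale (c k) (G k))) x) \<longlonglongrightarrow> eval_form (fst \<Phi>) x"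
    "\<forall>x. (\<lambda>k. eval_form (snd (form_scale (c k) (G k))) x) \<longlonglongrightarrow> eval_form (snd \<Phi>) x"
proof -
  obtain b0 i0 j0 where nz: "form_coord b0 i0 j0 \<Phi> \<noteq> 0" using form_pairs_coord_nonzero[OF \<Phi>] .
  define L where "L = form_coord b0 i0 j0"
  \<comment> \<open>the value $1$ matters only for the finitely many $k$ at which the reference coordinate vanishes\<close>
  define c where "c k = (if L (G k) = 0 then 1 else L \<Phi> / L (G k))" for k
  have c0: "c k \<noteq> 0" for k using nz by (simp add: c_def L_def)
  have coord_lim: "(\<lambda>k. form_coord b i j (form_scale (c k) (G k))) \<longlonglongrightarrow> form_coord b i j \<Phi>" for b i j
  proof (rule tendstoI)
    fix \<epsilon> :: real assume "\<epsilon> > 0"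
    define \<delta> where "\<delta> = \<epsilon> / cmod (L \<Phi>)"
    have \<delta>: "\<delta> > 0" using nz \<open>\<epsilon> > 0\<close> by (simp add: \<delta>_def L_def)
    show "\<forall>\<^sub>F k in sequentially. dist (form_coord b i j (form_scale (c k) (G k))) (form_coord b i j \<Phi>) < \<epsilon>"
      using RatBar_eventually_ratio[OF lim G \<Phi> nz \<delta>, of b i j]
    proof eventually_elim
      case (elim k)
      then have less: "cmod (form_coord b i j (G k) - form_coord b i j \<Phi> / L \<Phi> * L (G k)) < \<delta> * cmod (L (G k))"
        by (simp add: L_def)
      then have LG: "L (G k) \<noteq> 0" by auto
      have "form_coord b i j (form_scale (c k) (G k)) - form_coord b i j \<Phi> =
          (L \<Phi> / L (G k)) * (form_coord b i j (G k) - form_coord b i j \<Phi> / L \<Phi> * L (G k))"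
        using LG nz by (simp add: form_coord_scale c_def field_simps L_def[symmetric])
      then have "dist (form_coord b i j (form_scale (c k) (G k))) (form_coord b i j \<Phi>) =
          cmod (L \<Phi> / L (G k)) * cmod (form_coord b i j (G k) - form_coord b i j \<Phi> / L \<Phi> * L (G k))"
        by (simp only: dist_norm norm_mult)
      also have "\<dots> < cmod (L \<Phi> / L (G k)) * (\<delta> * cmod (L (G k)))"
        using LG nz less by (intro mult_strict_left_mono) (simp_all add: L_def)
      also have "\<dots> = \<epsilon>"
        using LG nz by (simp add: \<delta>_def norm_divide L_def)
      finally show ?case .
    qed
  qed
  have hom: "homogeneous d (fst \<Psi>)" "homogeneous d (snd \<Psi>)" if "\<Psi> \<in> form_pairs d" for \<Psi>
    using that by (auto simp: form_pairs_def)
  have scaled: "form_scale (c k) (G k) \<in> form_pairs d" for k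
    using G c0 by (rule form_scale_form_pairs)
  show ?thesis
  proof (rule that[of c]; intro allI)
    show "c k \<noteq> 0" for k by (rule c0)
    show "(\<lambda>k. eval_form (fst (form_scale (c k) (G k))) x) \<longlonglongrightarrow> eval_form (fst \<Phi>) x" for x
      unfolding eval_form_homogeneous[OF hom(1)[OF scaled]] eval_form_homogeneous[OF hom(1)[OF \<Phi>]]
      using coord_lim[of True] by (intro tendsto_sum tendsto_mult tendsto_const) (simp add: form_coord_def)
    show "(\<lambda>k. eval_form (snd (form_scale (c k) (G k))) x) \<longlonglongrightarrow> eval_form (snd \<Phi>) x" for x
      unfolding eval_form_homogeneous[OF hom(2)[OF scaled]] eval_form_homogeneous[OF hom(2)[OF \<Phi>]]
      using coord_lim[of False] by (intro tendsto_sum tendsto_mult tendsto_const) (simp add: form_coord_def)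
  qed
qed

section \<open>Moebius transformations\<close>

lemma invertible_mult_nonzero:
  fixes A :: "complex^2^2"
  assumes "invertible A" "v \<noteq> 0"
  shows "A *v v \<noteq> 0"
proof
  assume "A *v v = 0"
  obtain B where "B ** A = Finite_Cartesian_Product.mat 1" using assms(1) by (auto simp: invertible_def)
  then have "B *v (A *v v) = v" by (simp add: matrix_vector_mul_assoc)
  with \<open>A *v v = 0\<close> \<open>v \<noteq> 0\<close> show False by simp
qed

lemma moebius_map_abs:
  assumes "invertible A" "v \<noteq> 0"
  shows "moebius_map A (abs_cp1 v) = abs_cp1 (A *v v)"
proof -
  obtain c where c: "c \<noteq> 0" "rep_cp1 (abs_cp1 v) = c *s v" using rep_abs_cp1[OF assms(2)] .
  have "A *v (c *s v) = c *s (A *v v)" 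
    by (simp add: vec2_eq_iff matrix_vector_mult_def sum_2 algebra_simps)
  then show ?thesis
    using c(1) invertible_mult_nonzero[OF assms] by (simp add: moebius_map_def c(2))
qed

lemma continuous_moebius_map:
  assumes "invertible A"
  shows "continuous_on UNIV (moebius_map A)"
proof -
  have eq: "A *v v = (\<chi> i. A $ i $ 1 * v $ 1 + A $ i $ 2 * v $ 2)" for v
    unfolding matrix_vector_mult_def sum_2 ..
  have "continuous_on (- {0}) (\<lambda>v. A *v v)"
    unfolding eq by (auto intro!: continuous_intros)
  moreover have "A *v v \<in> - {0}" if "v \<in> - {0}" for v
    using that invertible_mult_nonzero[OF assms, of v] by simp
  then have "(\<lambda>v. A *v v) ` (- {0}) \<subseteq> - {0}" by (rule image_subsetI)
  ultimately have "continuous_on (- {0}) (\<lambda>v. abs_cp1 (A *v v))"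
    by (rule continuous_on_compose2[OF continuous_on_abs_cp1])
  then have "continuous_on (- {0}) (\<lambda>v. moebius_map A (abs_cp1 v))"
    by (rule continuous_on_eq) (simp add: moebius_map_abs assms)
  then show ?thesis by (simp only: continuous_on_cp1_iff)
qed

lemma pencil_moebius_comp_nonzero:
  assumes A: "invertible A" and \<Phi>: "\<And>v. v \<noteq> 0 \<Longrightarrow> pencil \<Phi> v \<noteq> 0" and "w \<noteq> 0"
  shows "pencil (moebius_comp A \<Phi>) w \<noteq> 0"
proof
  assume eq: "pencil (moebius_comp A \<Phi>) w = 0"
  obtain B where "A ** B = Finite_Cartesian_Product.mat 1" using A by (auto simp: invertible_def)
  then have w: "A *v (B *v w) = w" by (simp add: matrix_vector_mul_assoc)
  then have "B *v w \<noteq> 0" using \<open>w \<noteq> 0\<close> by auto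
  moreover have "cmul (Determinants.det A) (pencil \<Phi> (B *v w)) = 0"
    using eq pencil_moebius_comp[of A \<Phi> "B *v w"] by (simp only: w)
  moreover have "Determinants.det A \<noteq> 0" using A invertible_det_nz by blast
  ultimately show False using \<Phi>[of "B *v w"] by simp
qed

lemma moebius_comp_form_pairs:
  assumes A: "invertible A" and \<Phi>: "\<Phi> \<in> form_pairs d" "\<And>v. v \<noteq> 0 \<Longrightarrow> pencil \<Phi> v \<noteq> 0"
  shows "moebius_comp A \<Phi> \<in> form_pairs d"
proof -
  have "(vector [1, 0] :: complex^2) $ 1 \<noteq> 0 $ 1" by simp
  then have "(vector [1, 0] :: complex^2) \<noteq> 0" by metis
  with A \<Phi>(2) have "pencil (moebius_comp A \<Phi>) (vector [1, 0]) \<noteq> 0"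
    by (rule pencil_moebius_comp_nonzero)
  then have "moebius_comp A \<Phi> \<noteq> (0, 0)"
    by (rule contrapos_nn) (simp only: pencil_def fst_conv snd_conv smult_0_right diff_self)
  moreover have "homogeneous d (fst \<Phi>)" "homogeneous d (snd \<Phi>)"
    using \<Phi>(1) by (auto simp: form_pairs_def)
  then have "homogeneous d (fst (moebius_comp A \<Phi>)) \<and> homogeneous d (snd (moebius_comp A \<Phi>))"
    unfolding moebius_comp_def fst_conv snd_conv by (intro conjI homogeneous_add homogeneous_cmul)
  ultimately show ?thesis by (cases "moebius_comp A \<Phi>") (simp add: form_pairs_def)
qed

text \<open>
  The fibre of $A \circ \Phi$ over $A y$ is the fibre of $\Phi$ over $y$. This transfers the
  invariance of \<open>\<mu>\<close> under pullback by $f$ to a statement about $A \circ f$ and the push-forward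
  of \<open>\<mu>\<close> by $A$.
\<close>

lemma root_sum_pencil_moebius:
  assumes A: "invertible A" and "c \<noteq> 0"
  shows "root_sum (pencil (form_scale c (moebius_comp A \<Phi>)) (rep_cp1 (moebius_map A y))) \<psi> =
    root_sum (pencil \<Phi> (rep_cp1 y)) \<psi>"
proof -
  have nz: "A *v rep_cp1 y \<noteq> 0" using A by (rule invertible_mult_nonzero) simp
  have det: "Determinants.det A \<noteq> 0" using A invertible_det_nz by blast
  show ?thesis
    unfolding moebius_map_def pencil_form_scale root_sum_cmul[OF \<open>c \<noteq> 0\<close>]
      root_sum_pencil_abs[OF nz] pencil_moebius_comp root_sum_cmul[OF det] ..
qed

section \<open>Passing to the limit\<close>

lemma max_entropy_integral:
  fixes \<psi> :: "cp1 \<Rightarrow> real"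
  assumes f: "f \<in> Rat d" and "d > 0" and \<mu>: "max_entropy_measure d f \<mu>" and \<psi>: "continuous_on UNIV \<psi>"
  shows "real d * (\<integral>x. \<psi> x \<partial>\<mu>) = (\<integral>y. root_sum (pencil f (rep_cp1 y)) \<psi> \<partial>\<mu>)"
proof -
  have f': "f \<in> form_pairs d" "coprime (fst f) (snd f)" using f by (auto simp: Rat_def)
  have prob: "borel_prob \<mu>" and eq: "scale_measure (1 / of_nat d) (pullback_measure f \<mu>) = \<mu>"
    using \<mu> by (auto simp: max_entropy_measure_def)
  note pb = pullback_measure_characterization[OF f' \<open>d > 0\<close> prob]
  have r: "(1 / of_nat d :: ennreal) = ennreal (1 / real d)"
    using \<open>d > 0\<close> by (simp add: divide_ennreal[symmetric] ennreal_of_nat_eq_real_of_nat)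
  have b: "\<psi> \<in> borel_measurable (pullback_measure f \<mu>)"
    using borel_measurable_continuous_onI[OF \<psi>] pb(2) by (simp cong: measurable_cong_sets)
  have "(\<integral>x. \<psi> x \<partial>\<mu>) = (1 / real d) * (\<integral>x. \<psi> x \<partial>(pullback_measure f \<mu>))"
    using integral_scale_measure[OF b, of "1 / real d"] eq by (simp add: r)
  then show ?thesis using pb(3)[OF \<psi>] \<open>d > 0\<close> by simp
qed

text \<open>
  Uniform convergence absorbs the variation of the integrand, since all measures have mass one;
  weak convergence then applies to the fixed continuous limit function.
\<close>

lemma integral_tendsto_uniform:
  fixes T :: "nat \<Rightarrow> cp1 \<Rightarrow> real"
  assumes N: "\<And>k. prob_space (N k)" "\<And>k. sets (N k) = sets borel" and weak: "weakly_converges N \<nu>"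
    and T: "\<And>k. continuous_on UNIV (T k)" "continuous_on UNIV S"
    and unif: "\<And>\<epsilon>. \<epsilon> > 0 \<Longrightarrow> \<forall>\<^sub>F k in sequentially. \<forall>y. \<bar>T k y - S y\<bar> < \<epsilon>"
  shows "(\<lambda>k. \<integral>y. T k y \<partial>(N k)) \<longlonglongrightarrow> (\<integral>y. S y \<partial>\<nu>)"
proof -
  have int: "integrable (N k) g" if "continuous_on UNIV g" for k and g :: "cp1 \<Rightarrow> real"
    using N that by (intro integrable_continuous_cp1 prob_space.finite_measure)
  have "(\<lambda>k. (\<integral>y. T k y \<partial>(N k)) - (\<integral>y. S y \<partial>(N k))) \<longlonglongrightarrow> 0"
  proof (rule tendstoI)
    fix \<epsilon> :: real assume "\<epsilon> > 0"
    then have "\<epsilon> / 2 > 0" by simp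
    from unif[OF this]
    show "\<forall>\<^sub>F k in sequentially. dist ((\<integral>y. T k y \<partial>(N k)) - (\<integral>y. S y \<partial>(N k))) 0 < \<epsilon>"
    proof eventually_elim
      case (elim k)
      interpret prob_space "N k" by (rule N)
      have "\<bar>(\<integral>y. T k y \<partial>(N k)) - (\<integral>y. S y \<partial>(N k))\<bar> = \<bar>\<integral>y. T k y - S y \<partial>(N k)\<bar>"
        using int T by simp
      also have "\<dots> \<le> (\<integral>y. \<bar>T k y - S y\<bar> \<partial>(N k))" by (rule integral_abs_bound)
      also have "\<dots> \<le> (\<integral>y. \<epsilon> / 2 \<partial>(N k))"
        using elim int T by (intro integral_mono) (auto intro: less_imp_le continuous_intros)
      also have "\<dots> = \<epsilon> / 2" by (simp add: prob_space)
      finally show ?case using \<open>\<epsilon> > 0\<close> by simp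
    qed
  qed
  moreover have "(\<lambda>k. \<integral>y. S y \<partial>(N k)) \<longlonglongrightarrow> (\<integral>y. S y \<partial>\<nu>)"
    using weak T(2) by (simp add: weakly_converges_def)
  ultimately show ?thesis using tendsto_add by fastforce
qed

text \<open>
  The heart of the argument: the invariance of the measures of maximal entropy, written with
  unreduced forms, passes to the limit.
\<close>

lemma weak_limit_integral:
  fixes \<psi> :: "cp1 \<Rightarrow> real"
  assumes d: "d > 0" and f: "\<And>k. f k \<in> Rat d" and A: "\<And>k. invertible (A k)"
    and \<Phi>: "\<Phi> \<in> form_pairs d" "\<And>v. v \<noteq> 0 \<Longrightarrow> pencil \<Phi> v \<noteq> 0"
    and lim: "limitin (RatBar_topology d) (\<lambda>k. proj_class (moebius_comp (A k) (f k)))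
      (proj_class \<Phi>) sequentially"
    and \<mu>: "\<And>k. max_entropy_measure d (f k) (\<mu> k)"
    and weak: "A_weakly_converges A \<mu> \<mu>\<^sub>C \<mu>\<^sub>E"
    and \<psi>: "continuous_on UNIV \<psi>"
  shows "real d * (\<integral>x. \<psi> x \<partial>\<mu>\<^sub>C) = (\<integral>y. root_sum (pencil \<Phi> (rep_cp1 y)) \<psi> \<partial>\<mu>\<^sub>E)"
proof -
  have f': "f k \<in> form_pairs d" "coprime (fst (f k)) (snd (f k))" for k
    using f[of k] by (auto simp: Rat_def)
  have f_nz: "pencil (f k) v \<noteq> 0" if "v \<noteq> 0" for k v using pencil_nonzero[OF f' d that] .
  have g: "moebius_comp (A k) (f k) \<in> form_pairs d" for k
    using A f'(1) f_nz by (rule moebius_comp_form_pairs)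
  obtain c where c': "\<forall>k. c k \<noteq> 0"
    "\<forall>x. (\<lambda>k. eval_form (fst (form_scale (c k) (moebius_comp (A k) (f k)))) x) \<longlonglongrightarrow> eval_form (fst \<Phi>) x"
    "\<forall>x. (\<lambda>k. eval_form (snd (form_scale (c k) (moebius_comp (A k) (f k)))) x) \<longlonglongrightarrow> eval_form (snd \<Phi>) x"
    using RatBar_limit_representatives[OF lim g \<Phi>(1)] .
  note c = c'[rule_format]
  define G where "G k = form_scale (c k) (moebius_comp (A k) (f k))" for k
  have G: "G k \<in> form_pairs d" for k unfolding G_def using g c(1) by (rule form_scale_form_pairs)
  have G_nz: "pencil (G k) v \<noteq> 0" if "v \<noteq> 0" for k v
    unfolding G_def pencil_form_scale
    using pencil_moebius_comp_nonzero[OF A f_nz that] c(1) by simp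
  define N where "N k = distr (\<mu> k) borel (moebius_map (A k))" for k
  have \<mu>_prob: "prob_space (\<mu> k)" "sets (\<mu> k) = sets borel" for k
    using \<mu>[of k] by (auto simp: max_entropy_measure_def borel_prob_def)
  have meas: "moebius_map (A k) \<in> \<mu> k \<rightarrow>\<^sub>M borel" for k
    using borel_measurable_continuous_onI[OF continuous_moebius_map[OF A]] \<mu>_prob(2)
    by (simp cong: measurable_cong_sets)
  have N_prob: "prob_space (N k)" "sets (N k) = sets borel" for k
    unfolding N_def using \<mu>_prob(1) meas by (auto intro: prob_space.prob_space_distr)
  have TG: "continuous_on UNIV (\<lambda>y. root_sum (pencil (G k) (rep_cp1 y)) \<psi>)" for k
    by (rule continuous_on_root_sum_pencil[OF G G_nz \<psi>])
  have T\<Phi>: "continuous_on UNIV (\<lambda>y. root_sum (pencil \<Phi> (rep_cp1 y)) \<psi>)"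
    by (rule continuous_on_root_sum_pencil[OF \<Phi> \<psi>])
  have step: "real d * (\<integral>x. \<psi> x \<partial>\<mu> k) = (\<integral>y. root_sum (pencil (G k) (rep_cp1 y)) \<psi> \<partial>N k)" for k
  proof -
    have "real d * (\<integral>x. \<psi> x \<partial>\<mu> k) = (\<integral>y. root_sum (pencil (f k) (rep_cp1 y)) \<psi> \<partial>\<mu> k)"
      by (rule max_entropy_integral[OF f d \<mu> \<psi>])
    also have "\<dots> = (\<integral>y. root_sum (pencil (G k) (rep_cp1 (moebius_map (A k) y))) \<psi> \<partial>\<mu> k)"
      unfolding G_def root_sum_pencil_moebius[OF A c(1)] ..
    also have "\<dots> = (\<integral>y. root_sum (pencil (G k) (rep_cp1 y)) \<psi> \<partial>N k)"
      unfolding N_def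
      by (rule integral_distr[symmetric, OF meas borel_measurable_continuous_onI[OF TG]])
    finally show ?thesis .
  qed
  have "(\<lambda>k. \<integral>y. root_sum (pencil (G k) (rep_cp1 y)) \<psi> \<partial>N k) \<longlonglongrightarrow>
      (\<integral>y. root_sum (pencil \<Phi> (rep_cp1 y)) \<psi> \<partial>\<mu>\<^sub>E)"
  proof (rule integral_tendsto_uniform[OF N_prob _ TG T\<Phi>])
    show "weakly_converges N \<mu>\<^sub>E" using weak unfolding A_weakly_converges_def N_def by simp
    show "\<forall>\<^sub>F k in sequentially. \<forall>y.
        \<bar>root_sum (pencil (G k) (rep_cp1 y)) \<psi> - root_sum (pencil \<Phi> (rep_cp1 y)) \<psi>\<bar> < \<epsilon>" if "\<epsilon> > 0" for \<epsilon>
      by (rule root_sum_pencil_uniform[OF G G_nz \<Phi> c(2,3)[folded G_def] \<psi> that])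
  qed
  moreover have "(\<lambda>k. real d * (\<integral>x. \<psi> x \<partial>\<mu> k)) \<longlonglongrightarrow> real d * (\<integral>x. \<psi> x \<partial>\<mu>\<^sub>C)"
    using weak \<psi> by (intro tendsto_mult_left) (simp add: A_weakly_converges_def weakly_converges_def)
  ultimately show ?thesis unfolding step by (rule LIMSEQ_unique[symmetric])
qed

lemma emeasure_paired_pullback:
  assumes fin: "finite {x. surplus \<Phi> x \<noteq> 0}"
    and \<nu>: "sets (pullback_measure (reduction \<Phi>) \<mu>\<^sub>E) = sets borel"
  shows "sets (paired_pullback \<Phi> \<mu>\<^sub>C \<mu>\<^sub>E) = sets borel"
    and "B \<in> sets borel \<Longrightarrow> emeasure (paired_pullback \<Phi> \<mu>\<^sub>C \<mu>\<^sub>E) B =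
      emeasure (pullback_measure (reduction \<Phi>) \<mu>\<^sub>E) B +
        (\<Sum>x\<in>{x. surplus \<Phi> x \<noteq> 0}. of_nat (surplus \<Phi> x) * emeasure (return borel x) B)"
proof -
  let ?m = "\<lambda>B. emeasure (pullback_measure (reduction \<Phi>) \<mu>\<^sub>E) B +
        (\<Sum>x\<in>{x. surplus \<Phi> x \<noteq> 0}. of_nat (surplus \<Phi> x) * emeasure (return borel x) B)"
  have sets_eq: "sigma_sets UNIV (sets borel) = sets (borel :: cp1 measure)"
    using sets.sigma_sets_eq[of "borel :: cp1 measure"] unfolding space_borel .
  show s: "sets (paired_pullback \<Phi> \<mu>\<^sub>C \<mu>\<^sub>E) = sets borel"
    unfolding paired_pullback_def by (subst sets_measure_of) (simp_all only: sets_eq Pow_UNIV subset_UNIV)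
  have ca: "countably_additive (sets borel) ?m"
  proof (rule countably_additiveI)
    fix B :: "nat \<Rightarrow> cp1 set"
    assume B: "range B \<subseteq> sets borel" "disjoint_family B" "(\<Union>i. B i) \<in> sets borel"
    have ret: "(\<Sum>i. emeasure (return borel x) (B i)) = emeasure (return borel x) (\<Union>i. B i)" for x
      by (rule suminf_emeasure) (use B in auto)
    have pb: "(\<Sum>i. emeasure (pullback_measure (reduction \<Phi>) \<mu>\<^sub>E) (B i)) =
        emeasure (pullback_measure (reduction \<Phi>) \<mu>\<^sub>E) (\<Union>i. B i)"
      by (rule suminf_emeasure) (use B \<nu> in auto)
    have "(\<Sum>i. ?m (B i)) = (\<Sum>i. emeasure (pullback_measure (reduction \<Phi>) \<mu>\<^sub>E) (B i)) +
        (\<Sum>i. \<Sum>x\<in>{x. surplus \<Phi> x \<noteq> 0}. of_nat (surplus \<Phi> x) * emeasure (return borel x) (B i))"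
      by (rule suminf_add[OF summableI summableI, symmetric])
    also have "(\<Sum>i. \<Sum>x\<in>{x. surplus \<Phi> x \<noteq> 0}. of_nat (surplus \<Phi> x) * emeasure (return borel x) (B i)) =
        (\<Sum>x\<in>{x. surplus \<Phi> x \<noteq> 0}. \<Sum>i. of_nat (surplus \<Phi> x) * emeasure (return borel x) (B i))"
      by (rule suminf_sum[OF summableI])
    finally show "(\<Sum>i. ?m (B i)) = ?m (\<Union>i. B i)"
      unfolding ennreal_suminf_cmult pb ret .
  qed
  show "emeasure (paired_pullback \<Phi> \<mu>\<^sub>C \<mu>\<^sub>E) B = ?m B" if "B \<in> sets borel" for B
  proof (rule emeasure_measure_of[OF paired_pullback_def])
    show "positive (sets (paired_pullback \<Phi> \<mu>\<^sub>C \<mu>\<^sub>E)) ?m" by (simp add: positive_def)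
  qed (simp_all only: s that ca Pow_UNIV subset_UNIV)
qed

theorem theorem2p4:
  fixes d :: nat and f :: "nat \<Rightarrow> form_pair" and f0 \<Phi> :: form_pair
    and A :: "nat \<Rightarrow> complex^2^2" and \<mu> :: "nat \<Rightarrow> cp1 measure" and \<mu>\<^sub>C \<mu>\<^sub>E :: "cp1 measure"
  assumes "d \<ge> 2"
    and "\<And>k. f k \<in> Rat d"
    and "f0 \<in> bdry_Rat d"
    and "limitin (RatBar_topology d) (\<lambda>k. proj_class (f k)) (proj_class f0) sequentially"
    and "\<And>k. invertible (A k)"
    and "\<Phi> \<in> form_pairs d"
    and "limitin (RatBar_topology d) (\<lambda>k. proj_class (moebius_comp (A k) (f k)))
           (proj_class \<Phi>) sequentially"
    and "rat_degree (reduction \<Phi>) > 0"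
    and "\<not> rat_map (reduction f0) constant_on UNIV \<Longrightarrow> (\<forall>k. moebius_map (A k) = id)"
    and "\<And>k. max_entropy_measure d (f k) (\<mu> k)"
    and "A_weak_limit A \<mu> \<mu>\<^sub>C \<mu>\<^sub>E"
  shows "scale_measure (1 / of_nat d) (paired_pullback \<Phi> \<mu>\<^sub>C \<mu>\<^sub>E) = \<mu>\<^sub>C"
proof -
  have d: "d > 0" using \<open>d \<ge> 2\<close> by simp
  obtain r where r: "strict_mono r" and weak: "A_weakly_converges (A \<circ> r) (\<mu> \<circ> r) \<mu>\<^sub>C \<mu>\<^sub>E"
    using assms(11) unfolding A_weak_limit_def by blast
  have C: "prob_space \<mu>\<^sub>C" "sets \<mu>\<^sub>C = sets borel" and E: "borel_prob \<mu>\<^sub>E"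
    using weak by (auto simp: A_weakly_converges_def borel_prob_def)
  interpret C: prob_space \<mu>\<^sub>C by (rule C)
  define H where "H = common_factor \<Phi>"
  define \<phi> where "\<phi> = reduction \<Phi>"
  obtain h e where "h + e = d" and H: "homogeneous h H" "H \<noteq> 0" and \<phi>: "\<phi> \<in> form_pairs e" "coprime (fst \<phi>) (snd \<phi>)"
    and eq: "fst \<Phi> = H * fst \<phi>" "snd \<Phi> = H * snd \<phi>"
    using reduction_factorization[OF assms(6), folded H_def \<phi>_def] .
  have e: "e > 0" using assms(8) rat_degree_eq[OF \<phi>(1)] by (simp add: \<phi>_def)
  have \<phi>_nz: "pencil \<phi> v \<noteq> 0" if "v \<noteq> 0" for v by (rule pencil_nonzero[OF \<phi> e that])
  have \<Phi>_nz: "pencil \<Phi> v \<noteq> 0" if "v \<noteq> 0" for v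
    unfolding pencil_reduction[OF eq] using H(2) \<phi>_nz[OF that] by simp
  define \<nu> where "\<nu> = pullback_measure \<phi> \<mu>\<^sub>E"
  note pb = pullback_measure_characterization[OF \<phi> e E, folded \<nu>_def]
  interpret E: prob_space \<mu>\<^sub>E using E by (simp add: borel_prob_def)
  have lim: "limitin (RatBar_topology d) (\<lambda>k. proj_class (moebius_comp ((A \<circ> r) k) ((f \<circ> r) k)))
      (proj_class \<Phi>) sequentially"
    using limitin_subsequence[OF r assms(7)] by (simp add: o_def)
  have key: "real d * (\<integral>x. \<psi> x \<partial>\<mu>\<^sub>C) = (\<integral>x. \<psi> x \<partial>\<nu>) + root_sum H \<psi>"
    if \<psi>: "continuous_on UNIV \<psi>" for \<psi> :: "cp1 \<Rightarrow> real"
  proof -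
    have "real d * (\<integral>x. \<psi> x \<partial>\<mu>\<^sub>C) = (\<integral>y. root_sum (pencil \<Phi> (rep_cp1 y)) \<psi> \<partial>\<mu>\<^sub>E)"
      by (rule weak_limit_integral[OF d _ _ assms(6) \<Phi>_nz lim _ weak \<psi>])
        (simp_all only: o_apply assms(2,5,10) not_False_eq_True)
    also have "\<dots> = (\<integral>y. root_sum H \<psi> + root_sum (pencil \<phi> (rep_cp1 y)) \<psi> \<partial>\<mu>\<^sub>E)"
      unfolding pencil_reduction[OF eq]
      by (simp add: root_sum_mult[OF H homogeneous_pencil[OF \<phi>(1)] \<phi>_nz])
    also have "\<dots> = root_sum H \<psi> + (\<integral>x. \<psi> x \<partial>\<nu>)"
    proof -
      have "integrable \<mu>\<^sub>E (\<lambda>y. root_sum (pencil \<phi> (rep_cp1 y)) \<psi>)"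
        using E by (intro integrable_continuous_cp1 continuous_on_root_sum_pencil[OF \<phi>(1) \<phi>_nz \<psi>])
          (auto simp: borel_prob_def E.finite_measure)
      then show ?thesis using pb(3)[OF \<psi>] by (simp add: E.prob_space)
    qed
    finally show ?thesis by simp
  qed
  have surplus: "surplus \<Phi> x = ord_at x H" for x by (simp add: surplus_def H_def)
  have fin: "finite {x. surplus \<Phi> x \<noteq> 0}" unfolding surplus by (rule finite_ord_at[OF H(1)])
  have sets_red: "sets (pullback_measure (reduction \<Phi>) \<mu>\<^sub>E) = sets borel"
    using pb(2) by (simp add: \<nu>_def \<phi>_def)
  note P = emeasure_paired_pullback[where \<mu>\<^sub>C = \<mu>\<^sub>C, OF fin sets_red]
  have inv: "(1 / of_nat d :: ennreal) = ennreal (1 / real d)"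
    using d by (simp add: divide_ennreal[symmetric] ennreal_of_nat_eq_real_of_nat)
  have "emeasure \<mu>\<^sub>C B = emeasure (scale_measure (1 / of_nat d) (paired_pullback \<Phi> \<mu>\<^sub>C \<mu>\<^sub>E)) B"
    if "open B" for B
  proof -
    obtain \<psi> :: "nat \<Rightarrow> cp1 \<Rightarrow> real" where
      \<psi>: "\<And>n. continuous_on UNIV (\<psi> n)" "\<And>n x. 0 \<le> \<psi> n x" "\<And>n x. \<psi> n x \<le> 1"
        "\<And>x. (\<lambda>n. \<psi> n x) \<longlonglongrightarrow> indicator B x"
      using open_cp1_indicator_limit[OF \<open>open B\<close>] by blast
    \<comment> \<open>both sides of the integral identity, evaluated along test functions that tend to the indicator of $B$\<close>
    have "(\<lambda>n. real d * (\<integral>x. \<psi> n x \<partial>\<mu>\<^sub>C)) \<longlonglongrightarrow> real d * measure \<mu>\<^sub>C B"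
      by (intro tendsto_mult_left measure_open_limit[OF C.finite_measure C(2) that \<psi>])
    moreover have "(\<lambda>n. real d * (\<integral>x. \<psi> n x \<partial>\<mu>\<^sub>C)) \<longlonglongrightarrow> measure \<nu> B + root_sum H (indicator B)"
      unfolding key[OF \<psi>(1)] root_sum_def
      by (intro tendsto_add tendsto_sum tendsto_mult_left \<psi>(4) measure_open_limit[OF pb(1,2) that \<psi>])
    ultimately have m: "real d * measure \<mu>\<^sub>C B = measure \<nu> B + root_sum H (indicator B)"
      by (rule LIMSEQ_unique)
    have "(\<Sum>x\<in>{x. surplus \<Phi> x \<noteq> 0}. of_nat (surplus \<Phi> x) * emeasure (return borel x) B) =
        (\<Sum>x\<in>{x. ord_at x H \<noteq> 0}. ennreal (real (ord_at x H) * indicator B x))"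
      unfolding surplus using that
      by (intro sum.cong refl) (simp add: ennreal_mult ennreal_of_nat_eq_real_of_nat ennreal_indicator)
    also have "\<dots> = ennreal (root_sum H (indicator B))"
      unfolding root_sum_def by (rule sum_ennreal) simp
    finally have "emeasure (paired_pullback \<Phi> \<mu>\<^sub>C \<mu>\<^sub>E) B =
        ennreal (measure \<nu> B) + ennreal (root_sum H (indicator B))"
      using P(2)[of B] that
      by (simp add: finite_measure.emeasure_eq_measure[OF pb(1)] \<nu>_def[symmetric] \<phi>_def[symmetric])
    also have "\<dots> = ennreal (real d * measure \<mu>\<^sub>C B)"
      unfolding m by (rule ennreal_plus[symmetric])
        (auto simp: root_sum_def intro!: sum_nonneg)
    finally show ?thesis
      using d by (simp add: inv ennreal_mult[symmetric] C.emeasure_eq_measure)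
  qed
  then have "\<mu>\<^sub>C = scale_measure (1 / of_nat d) (paired_pullback \<Phi> \<mu>\<^sub>C \<mu>\<^sub>E)"
    using C(2) P(1) by (intro borel_measure_eqI_open C.finite_measure) simp_all
  then show ?thesis by simp
qed

end
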